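(* Let $F\in\mathcal C^\infty_c(\mathrm{HC})$. Then for all $\zeta\in\mathbb C$, $u\in\mathfrak U(\mathfrak{hc})$ and $x\in\mathbb R$, $$\widehat{L_{u;x}F}(\zeta)=\pi_{-\zeta}(u;x)\,\widehat F(\zeta),$$ where the product on the right is taken in the algebra $\mathcal H_{-\zeta}$.
   Context: Algebra. Let $V$ be a purely odd real super vector space of dimension $n\ge 1$ with a positive definite symmetric bilinear form $\beta$, and fix an orthonormal basis $a_1,\dots,a_n$. The Heisenberg--Clifford Lie superalgebra is $\mathfrak{hc}=V\oplus\mathbb R z$ with $z$ even and central, $V$ odd, and $[u+\lambda z,v+\mu z]=2\beta(u,v)z$. Its universal enveloping algebra $\mathfrak U(\mathfrak{hc})$ is the unital real superalgebra generated by odd $a_1,\dots,a_n$ and an even central element $z$ with $a_ia_j=-a_ja_i$ ($i\ne j$) and $a_i^2=z$. Parity is denoted $|\cdot|$. Put $\gamma=a_1\cdots a_n$. The antipode $S$ is the even unital linear map with $S(uv)=(-1)^{|u||v|}S(v)S(u)$ and $S(x)=-x$ for $x\in\mathfrak{hc}$. The coproduct $\Delta:\mathfrak U(\mathfrak{hc})\to\mathfrak U(\mathfrak{hc})\otimes\mathfrak U(\mathfrak{hc})$ is the even unital algebra homomorphism with $\Delta(x)=x\otimes1+1\otimes x$ for $x\in\mathfrak{hc}$, where $(a\otimes b)(c\otimes d)=(-1)^{|b||c|}ac\otimes bd$. Write $\Delta(\gamma)=\sum_i\gamma_i^{(1)}\otimes\gamma_i^{(2)}$ with homogeneous terms. Functions.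 $\mathcal C^\infty(\mathrm{HC})$ is the space of linear maps $F:\mathfrak U(\mathfrak{hc})\to C^\infty(\mathbb R)$ (complex-valued functions) with $F(zu)=F(u)'$ for all $u$; write $F(u;x)=F(u)(x)$. $F$ is even (odd) if it vanishes on odd (even) elements. $\mathcal C_c^\infty(\mathrm{HC})$ consists of those $F$ for which the supports of all $F(u)$ lie in a common compact set. For homogeneous $u,F$ define $(L_uF)(v;y)=(-1)^{|u||F|}F(S(u)v;y)$, and $(L_xF)(v;y)=F(v;y-x)$ for $x\in\mathbb R$; extend bilinearly and put $L_{u;x}=L_uL_x=L_xL_u$. Representations. For $\zeta\in\mathbb C$ put $\sigma=\begin{pmatrix}1&0\\0&-1\end{pmatrix}$, $X_\zeta=\begin{pmatrix}0&\zeta\\1&0\end{pmatrix}$, $Y_\zeta=\begin{pmatrix}0&i\zeta\\-i&0\end{pmatrix}$. If $n=2k$: $\mathcal H_\zeta=\mathrm{Mat}_{2^k}(\mathbb C)=\mathrm{End}((\mathbb C^{1|1})^{\otimes k})$, and for $1\le j\le k$, $c_\zeta(a_{2j-1})=\sigma^{\otimes(j-1)}\otimes X_\zeta\otimes 1^{\otimes(k-j)}$, $c_\zeta(a_{2j})=\sigma^{\otimes(j-1)}\otimes Y_\zeta\otimes1^{\otimes(k-j)}$. If $n=2k+1$: let $D_\zeta=\mathbb C[\epsilon]$ with $\epsilon$ odd, $\epsilon^2=\zeta$, and $\mathcal H_\zeta=D_\zeta\otimes\mathrm{Mat}_{2^k}(\mathbb C)=\mathrm{End}_{D_\zeta}(D_\zeta\otimes\mathbb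 C^{2^k})$; let $C_1,\dots,C_{2k}\in \mathrm{Mat}_{2^k}(\mathbb C)$ be the matrices $c_1(a_1),\dots,c_1(a_{2k})$ of the even case with parameter $1$, $\Gamma=\sigma^{\otimes k}$, and $c_\zeta(a_1)=\epsilon\otimes\Gamma$, $c_\zeta(a_{j+1})=\epsilon\otimes(-i\,\Gamma C_j)$ for $1\le j\le 2k$. In both cases $d\pi_\zeta:\mathfrak U(\mathfrak{hc})\to\mathcal H_\zeta$ is the unital algebra homomorphism with $d\pi_\zeta(a_j)=e^{i\pi/4}c_\zeta(a_j)$ and $d\pi_\zeta(z)=i\zeta$. Set $\pi_\zeta(u;x)=e^{i\zeta x}d\pi_\zeta(u)$. Fourier transform. For $F\in\mathcal C_c^\infty(\mathrm{HC})$ and $\zeta\in\mathbb C$, $\widehat F(\zeta)=\int_{\mathrm{HC}}F\cdot\pi_{-\zeta}\in\mathcal H_{-\zeta}$; since $\pi_{-\zeta}$ is even, explicitly $$\widehat F(\zeta)=\sum_i\Big(\int_{\mathbb R}F(\gamma_i^{(1)};x)e^{-i\zeta x}\,dx\Big)\,d\pi_{-\zeta}(\gamma_i^{(2)}).$$ *)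

theory Defs
  imports "HOL-Analysis.Analysis"
begin

section \<open>The universal enveloping algebra\<close>

text \<open>
  The orthonormal basis is indexed by a finite linearly ordered type \<open>'n\<close>, so that
  \<open>n = CARD('n)\<close> is an arbitrary positive number, \<open>V = real ^ 'n\<close> with its standard inner
  product, and the basis is \<open>a\<^sub>1, \<dots>, a\<^sub>n\<close> in the order of \<open>'n\<close>.
  The algebra is the one presented by generators and relations: terms modulo the least
  congruence containing the laws of a unital real algebra and the defining relations.
\<close>

datatype 'n uterm =
    GenA 'n | GenZ | Zero | One
  | Add "'n uterm" "'n uterm" | Mul "'n uterm" "'n uterm" | Scl real "'n uterm"

inductive ueq :: "'n uterm \<Rightarrow> 'n uterm \<Rightarrow> bool" where
  u_refl: "ueq s s"
| u_sym: "ueq s t \<Longrightarrow> ueq t s"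
| u_trans: "ueq s t \<Longrightarrow> ueq t r \<Longrightarrow> ueq s r"
| u_cong_add: "ueq s s' \<Longrightarrow> ueq t t' \<Longrightarrow> ueq (Add s t) (Add s' t')"
| u_cong_mul: "ueq s s' \<Longrightarrow> ueq t t' \<Longrightarrow> ueq (Mul s t) (Mul s' t')"
| u_cong_scl: "ueq s s' \<Longrightarrow> ueq (Scl c s) (Scl c s')"
| u_add_assoc: "ueq (Add (Add s t) r) (Add s (Add t r))"
| u_add_comm: "ueq (Add s t) (Add t s)"
| u_add_zero: "ueq (Add Zero s) s"
| u_add_inv: "ueq (Add (Scl (-1) s) s) Zero"
| u_scl_add: "ueq (Scl c (Add s t)) (Add (Scl c s) (Scl c t))"
| u_add_scl: "ueq (Scl (c + d) s) (Add (Scl c s) (Scl d s))"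
| u_scl_scl: "ueq (Scl c (Scl d s)) (Scl (c * d) s)"
| u_scl_one: "ueq (Scl 1 s) s"
| u_mul_assoc: "ueq (Mul (Mul s t) r) (Mul s (Mul t r))"
| u_one_mul: "ueq (Mul One s) s"
| u_mul_one: "ueq (Mul s One) s"
| u_add_mul: "ueq (Mul (Add s t) r) (Add (Mul s r) (Mul t r))"
| u_mul_add: "ueq (Mul s (Add t r)) (Add (Mul s t) (Mul s r))"
| u_scl_mul: "ueq (Mul (Scl c s) t) (Scl c (Mul s t))"
| u_mul_scl: "ueq (Mul s (Scl c t)) (Scl c (Mul s t))"
| u_rel_anticomm: "i \<noteq> j \<Longrightarrow> ueq (Mul (GenA i) (GenA j)) (Scl (-1) (Mul (GenA j) (GenA i)))"
| u_rel_square: "ueq (Mul (GenA i) (GenA i)) GenZ"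
| u_rel_central: "ueq (Mul GenZ (GenA i)) (Mul (GenA i) GenZ)"

quotient_type 'n uhc = "'n uterm" / ueq
  by (rule equivpI) (auto simp: reflp_def symp_def transp_def intro: ueq.intros)

primrec ueval ::
  "('b \<Rightarrow> 'b \<Rightarrow> 'b) \<Rightarrow> 'b \<Rightarrow> ('n \<Rightarrow> 'b) \<Rightarrow> 'b \<Rightarrow> 'n uterm \<Rightarrow> 'b::real_vector" where
  "ueval mul e f w (GenA i) = f i"
| "ueval mul e f w GenZ = w"
| "ueval mul e f w Zero = 0"
| "ueval mul e f w One = e"
| "ueval mul e f w (Add s t) = ueval mul e f w s + ueval mul e f w t"
| "ueval mul e f w (Mul s t) = mul (ueval mul e f w s) (ueval mul e f w t)"
| "ueval mul e f w (Scl c s) = c *\<^sub>R ueval mul e f w s"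

definition unital_algebra :: "('b::real_vector \<Rightarrow> 'b \<Rightarrow> 'b) \<Rightarrow> 'b \<Rightarrow> bool" where
  "unital_algebra mul e \<longleftrightarrow> bilinear mul \<and>
     (\<forall>x y w. mul (mul x y) w = mul x (mul y w)) \<and> (\<forall>x. mul e x = x \<and> mul x e = x)"

definition hc_relations :: "('b::real_vector \<Rightarrow> 'b \<Rightarrow> 'b) \<Rightarrow> ('n \<Rightarrow> 'b) \<Rightarrow> 'b \<Rightarrow> bool" where
  "hc_relations mul f w \<longleftrightarrow>
     (\<forall>i j. i \<noteq> j \<longrightarrow> mul (f i) (f j) = - mul (f j) (f i)) \<and>
     (\<forall>i. mul (f i) (f i) = w) \<and> (\<forall>i. mul w (f i) = mul (f i) w)"

lemma ueval_respects:
  assumes "unital_algebra mul e" "hc_relations mul f w" "ueq s t"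
  shows "ueval mul e f w s = ueval mul e f w t"
proof -
  have b: "bilinear mul" using assms(1) by (simp add: unital_algebra_def)
  have A: "mul (mul x y) v = mul x (mul y v)" "mul e x = x" "mul x e = x" for x y v
    using assms(1) by (auto simp: unital_algebra_def)
  show ?thesis
    using assms(3)
  proof induction
    case (u_rel_anticomm i j)
    then have "mul (f i) (f j) = - mul (f j) (f i)"
      using assms(2) unfolding hc_relations_def by blast
    then show ?case by simp
  next
    case (u_rel_square i)
    then show ?case using assms(2) by (simp add: hc_relations_def)
  next
    case (u_rel_central i)
    then show ?case using assms(2) by (simp add: hc_relations_def)
  qed (simp_all add: A bilinear_ladd[OF b] bilinear_radd[OF b] bilinear_lmul[OF b]
         bilinear_rmul[OF b] algebra_simps)
qed

instantiation uhc :: (type) real_algebra_1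
begin

lift_definition zero_uhc :: "'a uhc" is Zero .
lift_definition one_uhc :: "'a uhc" is One .
lift_definition plus_uhc :: "'a uhc \<Rightarrow> 'a uhc \<Rightarrow> 'a uhc" is Add by (rule ueq.u_cong_add)
lift_definition times_uhc :: "'a uhc \<Rightarrow> 'a uhc \<Rightarrow> 'a uhc" is Mul by (rule ueq.u_cong_mul)
lift_definition scaleR_uhc :: "real \<Rightarrow> 'a uhc \<Rightarrow> 'a uhc" is Scl by (rule ueq.u_cong_scl)
lift_definition uminus_uhc :: "'a uhc \<Rightarrow> 'a uhc" is "Scl (-1)" by (rule ueq.u_cong_scl)
lift_definition minus_uhc :: "'a uhc \<Rightarrow> 'a uhc \<Rightarrow> 'a uhc" is "\<lambda>s t. Add s (Scl (-1) t)"
  by (intro ueq.u_cong_add ueq.u_cong_scl)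

instance
proof
  show "(0::'a uhc) \<noteq> 1"
  proof transfer
    show "\<not> ueq (Zero :: 'a uterm) One"
    proof
      assume "ueq (Zero :: 'a uterm) One"
      from ueval_respects[OF _ _ this, of "(*)" "1::real" "\<lambda>_. 0" 0]
      show False
        by (simp add: unital_algebra_def hc_relations_def bilinear_def linear_iff algebra_simps)
    qed
  qed
qed (transfer, auto intro: ueq.intros)+

end

lift_definition hc_a :: "'n \<Rightarrow> 'n uhc" is GenA .
lift_definition hc_z :: "'n uhc" is GenZ .

lemma hc_a_anticomm: "i \<noteq> j \<Longrightarrow> hc_a i * hc_a j = - (hc_a j * hc_a i)"
  by transfer (rule ueq.u_rel_anticomm)

lemma hc_a_square: "hc_a i * hc_a i = hc_z"
  by transfer (rule ueq.u_rel_square)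

lemma hc_z_commute_a: "hc_z * hc_a i = hc_a i * hc_z"
  by transfer (rule ueq.u_rel_central)

lemma uhc_induct [case_names a z zero one add mult scale]:
  assumes "\<And>i. P (hc_a i)" "P hc_z" "P 0" "P 1"
    and "\<And>u v. P u \<Longrightarrow> P v \<Longrightarrow> P (u + v)" "\<And>u v. P u \<Longrightarrow> P v \<Longrightarrow> P (u * v)"
    and "\<And>c u. P u \<Longrightarrow> P (c *\<^sub>R u)"
  shows "P (u :: 'n uhc)"
proof -
  have "P (abs_uhc t)" for t
    by (induction t)
      (use assms in \<open>simp_all flip: hc_a.abs_eq hc_z.abs_eq zero_uhc.abs_eq one_uhc.abs_eq
         plus_uhc.abs_eq times_uhc.abs_eq scaleR_uhc.abs_eq\<close>)
  then show ?thesis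
    by (metis Quotient3_abs_rep Quotient3_uhc)
qed

lemma hc_z_central: "hc_z * u = u * hc_z"
proof (induction u rule: uhc_induct)
  case (mult u v)
  then show ?case by (metis mult.assoc)
qed (auto simp: hc_z_commute_a algebra_simps)

text \<open>
  The value of a homomorphism on an element of the quotient is computed on a representative;
  it is independent of the representative whenever the target is a unital algebra in which
  the relations hold.
\<close>

definition uhc_lift :: "('b \<Rightarrow> 'b \<Rightarrow> 'b) \<Rightarrow> 'b \<Rightarrow> ('n \<Rightarrow> 'b) \<Rightarrow> 'b \<Rightarrow> 'n uhc \<Rightarrow> 'b::real_vector" where
  "uhc_lift mul e f w u = ueval mul e f w (rep_uhc u)"

lemma uhc_lift_abs:
  assumes "unital_algebra mul e" "hc_relations mul f w"
  shows "uhc_lift mul e f w (abs_uhc t) = ueval mul e f w t"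
  unfolding uhc_lift_def
  by (rule ueval_respects[OF assms])
    (metis Quotient3_rel_abs Quotient3_uhc rep_abs_rsp ueq.u_refl ueq.u_sym)

lemma uhc_lift_hom:
  assumes "unital_algebra mul e" "hc_relations mul f w"
  shows "uhc_lift mul e f w (hc_a i) = f i"
    and "uhc_lift mul e f w hc_z = w"
    and "uhc_lift mul e f w 0 = 0"
    and "uhc_lift mul e f w 1 = e"
    and "uhc_lift mul e f w (u + v) = uhc_lift mul e f w u + uhc_lift mul e f w v"
    and "uhc_lift mul e f w (u * v) = mul (uhc_lift mul e f w u) (uhc_lift mul e f w v)"
    and "uhc_lift mul e f w (c *\<^sub>R u) = c *\<^sub>R uhc_lift mul e f w u"
    and "linear (uhc_lift mul e f w)"
proof -
  note abs = uhc_lift_abs[OF assms]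
  obtain s t where uv: "u = abs_uhc s" "v = abs_uhc t"
    by (metis Quotient3_abs_rep Quotient3_uhc)
  show "uhc_lift mul e f w (hc_a i) = f i" "uhc_lift mul e f w hc_z = w"
    "uhc_lift mul e f w 0 = 0" "uhc_lift mul e f w 1 = e"
    by (simp_all add: hc_a.abs_eq hc_z.abs_eq zero_uhc.abs_eq one_uhc.abs_eq abs)
  show "uhc_lift mul e f w (u + v) = uhc_lift mul e f w u + uhc_lift mul e f w v"
    "uhc_lift mul e f w (u * v) = mul (uhc_lift mul e f w u) (uhc_lift mul e f w v)"
    "uhc_lift mul e f w (c *\<^sub>R u) = c *\<^sub>R uhc_lift mul e f w u"
    by (simp_all add: uv plus_uhc.abs_eq times_uhc.abs_eq scaleR_uhc.abs_eq abs)
  show "linear (uhc_lift mul e f w)"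
  proof (rule linearI)
    fix x y :: "'b uhc" and c :: real
    obtain s t where "x = abs_uhc s" "y = abs_uhc t"
      by (metis Quotient3_abs_rep Quotient3_uhc)
    then show "uhc_lift mul e f w (x + y) = uhc_lift mul e f w x + uhc_lift mul e f w y"
      "uhc_lift mul e f w (c *\<^sub>R x) = c *\<^sub>R uhc_lift mul e f w x"
      by (simp_all add: plus_uhc.abs_eq scaleR_uhc.abs_eq abs)
  qed
qed

text \<open>The inclusion of \<open>V \<oplus> \<real> z\<close> and the bracket relation of the Lie superalgebra.\<close>

definition hc_emb :: "(real ^ 'n) \<times> real \<Rightarrow> 'n::finite uhc" where
  "hc_emb = (\<lambda>(v, c). (\<Sum>i\<in>UNIV. (v $ i) *\<^sub>R hc_a i) + c *\<^sub>R hc_z)"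

lemma hc_emb_bracket:
  fixes v w :: "real ^ 'n"
  shows "hc_emb (v, 0) * hc_emb (w, 0) + hc_emb (w, 0) * hc_emb (v, 0) = hc_emb (0, 2 * (v \<bullet> w))"
proof -
  have *: "hc_a i * hc_a j + hc_a j * hc_a i = (if i = j then 2 *\<^sub>R hc_z else 0)" for i j :: 'n
    using hc_a_anticomm[of i j] by (auto simp: hc_a_square scaleR_2)
  have "hc_emb (v, 0) * hc_emb (w, 0) + hc_emb (w, 0) * hc_emb (v, 0)
      = (\<Sum>i\<in>UNIV. \<Sum>j\<in>UNIV. (v $ i * w $ j) *\<^sub>R (hc_a i * hc_a j))
        + (\<Sum>j\<in>UNIV. \<Sum>i\<in>UNIV. (v $ i * w $ j) *\<^sub>R (hc_a j * hc_a i))"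
    by (simp add: hc_emb_def sum_product mult.commute)
  also have "\<dots> = (\<Sum>i\<in>UNIV. \<Sum>j\<in>UNIV. (v $ i * w $ j) *\<^sub>R (hc_a i * hc_a j + hc_a j * hc_a i))"
    by (subst (2) sum.swap) (simp add: sum.distrib scaleR_add_right)
  also have "\<dots> = (\<Sum>i\<in>UNIV. (v $ i * w $ i * 2) *\<^sub>R hc_z)"
    by (simp add: * if_distrib cong: if_cong)
  also have "\<dots> = hc_emb (0, 2 * (v \<bullet> w))"
    by (simp add: hc_emb_def inner_vec_def scaleR_sum_left sum_distrib_left mult.commute)
  finally show ?thesis .
qed

section \<open>Parity\<close>

text \<open>
  Parities are the naturals \<open>0\<close> and \<open>1\<close>. The projection \<open>hpart p\<close> onto the component of parity
  \<open>p\<close> is obtained from the automorphism \<open>grading\<close>, which is \<open>-1\<close> exactly on odd elements; see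
  \<open>hpart_sum\<close>, \<open>hpart_in_homog\<close> and \<open>hpart_homog\<close>.
\<close>

definition homog :: "nat \<Rightarrow> 'n uhc set" where
  "homog p = span {hc_z ^ k * prod_list (map hc_a is) | k is. length is mod 2 = p}"

definition grading :: "'n uhc \<Rightarrow> 'n uhc" where
  "grading = uhc_lift (*) 1 (\<lambda>i. - hc_a i) hc_z"

definition hpart :: "nat \<Rightarrow> 'n uhc \<Rightarrow> 'n uhc" where
  "hpart p u = (1/2) *\<^sub>R (u + (-1) ^ p *\<^sub>R grading u)"

lemma unital_algebra_uhc: "unital_algebra (*) (1 :: 'n uhc)"
  by (simp add: unital_algebra_def bilinear_def linear_iff algebra_simps)

lemma hc_relations_grading: "hc_relations (*) (\<lambda>i. - hc_a i) (hc_z :: 'n uhc)"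
  unfolding hc_relations_def
proof (intro conjI allI impI)
  show "- hc_a i * - hc_a j = - (- hc_a j * - hc_a i)" if "i \<noteq> j" for i j :: 'n
    using hc_a_anticomm[OF that] by simp
qed (simp_all add: hc_a_square hc_z_central)

lemmas grading_hom =
  uhc_lift_hom[OF unital_algebra_uhc hc_relations_grading, folded grading_def]

lemma grading_power [simp]: "grading (u ^ k) = grading u ^ k"
  by (induction k) (simp_all add: grading_hom)

lemma grading_prod_list: "grading (prod_list (map hc_a is)) = (-1) ^ length is *\<^sub>R prod_list (map hc_a is)"
  by (induction "is") (simp_all add: grading_hom)

lemma grading_grading [simp]: "grading (grading u) = u"
proof -
  have m: "grading (- v) = - grading v" for v :: "'a uhc"
    using grading_hom(7)[of "-1" v] by simp
  show ?thesis
    by (induction u rule: uhc_induct) (simp_all add: grading_hom m)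
qed

lemma subspace_homog: "subspace (homog p)"
  by (simp add: homog_def)

lemma homog_generators:
  "1 \<in> homog 0" "hc_z \<in> homog 0" "hc_a i \<in> homog (Suc 0)"
proof -
  have *: "hc_z ^ k * prod_list (map hc_a is) \<in> homog (length is mod 2)" for k and "is" :: "'n list"
    unfolding homog_def by (rule span_base) blast
  show "(1::'n uhc) \<in> homog 0" "(hc_z::'n uhc) \<in> homog 0" "hc_a i \<in> homog (Suc 0)"
    using *[of 0 "[]"] *[of 1 "[]"] *[of 0 "[i]" for i] by simp_all
qed

lemma homog_mult:
  assumes x: "x \<in> homog p" and y: "y \<in> homog q"
  shows "x * y \<in> homog ((p + q) mod 2)"
  using x unfolding homog_def[of p]
proof (induction rule: span_induct_alt)
  case base
  show ?case by (simp add: subspace_0[OF subspace_homog])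
next
  case (step c x x')
  then obtain k "is" where x: "x = hc_z ^ k * prod_list (map hc_a is)" and l: "length is mod 2 = p"
    by auto
  have "x * y \<in> homog ((p + q) mod 2)"
    using y unfolding homog_def[of q]
  proof (induction rule: span_induct_alt)
    case base
    show ?case by (simp add: subspace_0[OF subspace_homog])
  next
    case (step d y y')
    then obtain m js where y: "y = hc_z ^ m * prod_list (map hc_a js)" and l': "length js mod 2 = q"
      by auto
    have zc: "hc_z ^ m * v = v * hc_z ^ m" for v :: "'a uhc"
      by (metis power_commuting_commutes hc_z_central)
    have "x * y = hc_z ^ k * (prod_list (map hc_a is) * hc_z ^ m) * prod_list (map hc_a js)"
      unfolding x y by (simp add: mult.assoc)
    also have "\<dots> = hc_z ^ (k + m) * prod_list (map hc_a (is @ js))"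
      unfolding zc[symmetric] by (simp add: power_add mult.assoc)
    finally have "x * y = hc_z ^ (k + m) * prod_list (map hc_a (is @ js))" .
    moreover have "length (is @ js) mod 2 = (p + q) mod 2"
      using l l' by (auto simp: mod_add_eq)
    ultimately have "x * y \<in> homog ((p + q) mod 2)"
      unfolding homog_def by (intro span_base) blast
    then show ?case
      using step by (simp add: distrib_left subspace_add[OF subspace_homog] subspace_scale[OF subspace_homog])
  qed
  then show ?case
    using step by (simp add: distrib_right subspace_add[OF subspace_homog] subspace_scale[OF subspace_homog])
qed

lemma homog_decomp: "\<exists>x y. x \<in> homog 0 \<and> y \<in> homog (Suc 0) \<and> v = x + y"
proof (induction v rule: uhc_induct)
  case (a i) then show ?case using homog_generators subspace_0[OF subspace_homog] by force
next
  case z then show ?case using homog_generators subspace_0[OF subspace_homog] by force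
next
  case zero then show ?case using subspace_0[OF subspace_homog] by force
next
  case one then show ?case using homog_generators subspace_0[OF subspace_homog] by force
next
  case (add u v)
  then obtain x y x' y' where "x \<in> homog 0" "y \<in> homog (Suc 0)" "u = x + y"
    "x' \<in> homog 0" "y' \<in> homog (Suc 0)" "v = x' + y'" by blast
  then show ?case
    by (intro exI[of _ "x + x'"] exI[of _ "y + y'"]) (auto intro: subspace_add[OF subspace_homog])
next
  case (mult u v)
  then obtain x y x' y' where h: "x \<in> homog 0" "y \<in> homog (Suc 0)" "u = x + y"
    "x' \<in> homog 0" "y' \<in> homog (Suc 0)" "v = x' + y'" by blast
  have "x * x' \<in> homog 0" "y * y' \<in> homog 0" "x * y' \<in> homog (Suc 0)" "y * x' \<in> homog (Suc 0)"
    using homog_mult[of x 0 x' 0] homog_mult[of y 1 y' 1] homog_mult[of x 0 y' 1]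
      homog_mult[of y 1 x' 0] h by simp_all
  then show ?case
    using h by (intro exI[of _ "x * x' + y * y'"] exI[of _ "x * y' + y * x'"])
      (auto intro!: subspace_add[OF subspace_homog] simp: algebra_simps)
next
  case (scale c u)
  then obtain x y where "x \<in> homog 0" "y \<in> homog (Suc 0)" "u = x + y" by blast
  then show ?case
    by (intro exI[of _ "c *\<^sub>R x"] exI[of _ "c *\<^sub>R y"])
      (auto intro: subspace_scale[OF subspace_homog] simp: scaleR_add_right)
qed

lemma grading_homog:
  assumes "u \<in> homog p"
  shows "grading u = (-1) ^ p *\<^sub>R u"
  using assms unfolding homog_def
proof (induction rule: span_induct_alt)
  case base
  then show ?case by (simp add: grading_hom)
next
  case (step c x y)
  then obtain k "is" where x: "x = hc_z ^ k * prod_list (map hc_a is)" and l: "length is mod 2 = p"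
    by auto
  have "(-1::real) ^ length is = (-1) ^ p"
    using l by (auto simp: minus_one_power_iff)
  then show ?case
    using step by (simp add: x grading_hom grading_prod_list scaleR_add_right mult.commute)
qed

lemma hpart_linear: "linear (hpart p)"
  by (rule linearI) (simp_all add: hpart_def grading_hom algebra_simps)

lemma hpart_sum: "hpart 0 u + hpart (Suc 0) u = u"
  by (simp add: hpart_def flip: scaleR_add_right)

lemma hpart_homog:
  assumes "u \<in> homog p" "p < 2" "q < 2"
  shows "hpart q u = (if q = p then u else 0)"
proof -
  have "p = 0 \<or> p = 1" "q = 0 \<or> q = 1" using assms by auto
  then show ?thesis
    using grading_homog[OF assms(1)] by (auto simp: hpart_def scaleR_2[symmetric])
qed

lemma hpart_in_homog:
  assumes "p < 2"
  shows "hpart p u \<in> homog p"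
proof -
  obtain x y where "x \<in> homog 0" "y \<in> homog (Suc 0)" "u = x + y"
    using homog_decomp by blast
  moreover have "p = 0 \<or> p = Suc 0" using assms by auto
  ultimately show ?thesis
    by (auto simp: linear_add[OF hpart_linear] hpart_homog)
qed

section \<open>Antipode\<close>

lemma homog_sum_induct [consumes 0, case_names homog add]:
  assumes "\<And>p u. p < 2 \<Longrightarrow> u \<in> homog p \<Longrightarrow> P u" "\<And>u v. P u \<Longrightarrow> P v \<Longrightarrow> P (u + v)"
  shows "P u"
  using assms(1)[OF _ hpart_in_homog, of 0 u] assms(1)[OF _ hpart_in_homog, of 1 u]
    assms(2)[of "hpart 0 u" "hpart 1 u"] by (simp add: hpart_sum)

text \<open>The antipode is a homomorphism into the algebra with product \<open>(-1)\<^bsup>|x||y|\<^esup> y x\<close>.\<close>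

definition sop_mult :: "'n uhc \<Rightarrow> 'n uhc \<Rightarrow> 'n uhc" where
  "sop_mult x y = (\<Sum>p\<in>{0, 1}. \<Sum>q\<in>{0, 1}. (-1) ^ (p * q) *\<^sub>R (hpart q y * hpart p x))"

definition antipode :: "'n uhc \<Rightarrow> 'n uhc" where
  "antipode = uhc_lift sop_mult 1 (\<lambda>i. - hc_a i) (- hc_z)"

lemma bilinear_sop_mult: "bilinear sop_mult"
  by (simp add: bilinear_def linear_iff sop_mult_def linear_add[OF hpart_linear]
      linear_cmul[OF hpart_linear] algebra_simps)

lemma sop_mult_homog:
  assumes "x \<in> homog p" "y \<in> homog q" "p < 2" "q < 2"
  shows "sop_mult x y = (-1) ^ (p * q) *\<^sub>R (y * x)"
  using assms(3,4) hpart_homog[OF assms(1,3)] hpart_homog[OF assms(2,4)]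
  by (auto simp: sop_mult_def less_2_cases_iff)

lemma unital_algebra_sop: "unital_algebra sop_mult (1 :: 'n uhc)"
  unfolding unital_algebra_def
proof (intro conjI allI)
  note bl = bilinear_ladd[OF bilinear_sop_mult] bilinear_radd[OF bilinear_sop_mult]
    bilinear_lmul[OF bilinear_sop_mult] bilinear_rmul[OF bilinear_sop_mult]
  show "bilinear (sop_mult :: 'n uhc \<Rightarrow> _)" by (rule bilinear_sop_mult)
  show "sop_mult (sop_mult x y) w = sop_mult x (sop_mult y w)" for x y w :: "'n uhc"
  proof (induction x rule: homog_sum_induct)
    case x: (homog p x)
    show ?case
    proof (induction y rule: homog_sum_induct)
      case y: (homog q y)
      show ?case
      proof (induction w rule: homog_sum_induct)
        case w: (homog r w)
        have yx: "y * x \<in> homog ((q + p) mod 2)" and wy: "w * y \<in> homog ((r + q) mod 2)"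
          using x y w homog_mult by blast+
        show ?case
          using x y w yx wy
          by (simp add: sop_mult_homog[OF x(2) y(2)] sop_mult_homog[OF y(2) w(2)]
              sop_mult_homog[OF yx w(2)] sop_mult_homog[OF x(2) wy] bl mult.assoc)
            (auto simp: less_2_cases_iff)
      qed (simp add: bl)
    qed (simp add: bl)
  qed (simp add: bl)
  show "sop_mult 1 x = x" "sop_mult x 1 = x" for x :: "'n uhc"
    by (induction x rule: homog_sum_induct)
      (simp_all add: sop_mult_homog[OF homog_generators(1)] sop_mult_homog[OF _ homog_generators(1)] bl)
qed

lemma hc_relations_sop: "hc_relations sop_mult (\<lambda>i. - hc_a i) (- hc_z :: 'n uhc)"
  unfolding hc_relations_def
proof (intro conjI allI impI)
  note a = homog_generators(3) subspace_neg[OF subspace_homog homog_generators(3)]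
  note z = subspace_neg[OF subspace_homog homog_generators(2)]
  fix i j :: 'n
  show "sop_mult (- hc_a i) (- hc_a j) = - sop_mult (- hc_a j) (- hc_a i)" if "i \<noteq> j"
    using hc_a_anticomm[OF that] by (simp add: sop_mult_homog[OF a(2) a(2)])
  show "sop_mult (- hc_a i) (- hc_a i) = - hc_z"
    by (simp add: sop_mult_homog[OF a(2) a(2)] hc_a_square)
  show "sop_mult (- hc_z) (- hc_a i) = sop_mult (- hc_a i) (- hc_z)"
    by (simp add: sop_mult_homog[OF z a(2)] sop_mult_homog[OF a(2) z] hc_z_central)
qed

lemmas antipode_hom = uhc_lift_hom[OF unital_algebra_sop hc_relations_sop, folded antipode_def]

lemma hpart_hpart: "r < 2 \<Longrightarrow> s < 2 \<Longrightarrow> hpart s (hpart r w) = (if s = r then hpart r w else 0)"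
  by (simp add: hpart_homog[OF hpart_in_homog])

lemma hpart_mult:
  "hpart 0 (x * y) = hpart 0 x * hpart 0 y + hpart (Suc 0) x * hpart (Suc 0) y"
  "hpart (Suc 0) (x * y) = hpart 0 x * hpart (Suc 0) y + hpart (Suc 0) x * hpart 0 y"
proof -
  have h: "hpart s (hpart p x * hpart q y) = (if s = (p + q) mod 2 then hpart p x * hpart q y else 0)"
    if "p < 2" "q < 2" "s < 2" for p q s
    using that by (simp add: hpart_homog[OF homog_mult[OF hpart_in_homog hpart_in_homog]])
  have e: "x * y = hpart 0 x * hpart 0 y + hpart 0 x * hpart (Suc 0) y
      + (hpart (Suc 0) x * hpart 0 y + hpart (Suc 0) x * hpart (Suc 0) y)"
    by (simp flip: distrib_left distrib_right add: hpart_sum)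
  show "hpart 0 (x * y) = hpart 0 x * hpart 0 y + hpart (Suc 0) x * hpart (Suc 0) y"
    "hpart (Suc 0) (x * y) = hpart 0 x * hpart (Suc 0) y + hpart (Suc 0) x * hpart 0 y"
    by (subst e, simp add: linear_add[OF hpart_linear] h)+
qed

lemma hpart_antipode: "s < 2 \<Longrightarrow> hpart s (antipode w) = antipode (hpart s w)"
proof (induction w arbitrary: s rule: uhc_induct)
  case (a i)
  then show ?case
    by (simp add: hpart_homog[OF homog_generators(3)] antipode_hom linear_neg[OF hpart_linear])
next
  case z
  then show ?case
    by (simp add: hpart_homog[OF homog_generators(2)] antipode_hom linear_neg[OF hpart_linear])
next
  case zero
  then show ?case by (simp add: antipode_hom linear_0[OF hpart_linear])
next
  case one
  then show ?case by (simp add: hpart_homog[OF homog_generators(1)] antipode_hom)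
next
  case (add u v)
  then show ?case by (simp add: antipode_hom linear_add[OF hpart_linear])
next
  case (scale c u)
  then show ?case by (simp add: antipode_hom linear_cmul[OF hpart_linear])
next
  case (mult u v)
  have "hpart 0 (antipode u) = antipode (hpart 0 u)" "hpart (Suc 0) (antipode u) = antipode (hpart (Suc 0) u)"
    "hpart 0 (antipode v) = antipode (hpart 0 v)" "hpart (Suc 0) (antipode v) = antipode (hpart (Suc 0) v)"
    using mult.IH by simp_all
  note IH = this this[THEN arg_cong[where f = "hpart 0"]] this[THEN arg_cong[where f = "hpart (Suc 0)"]]
  have "s = 0 \<or> s = Suc 0" using mult.prems by auto
  then show ?case
    by (auto simp: antipode_hom IH[symmetric] sop_mult_def hpart_mult hpart_hpart linear_add[OF hpart_linear]
        linear_diff[OF hpart_linear] linear_neg[OF hpart_linear] linear_0[OF hpart_linear])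
qed

lemma antipode_mult:
  assumes "u \<in> homog p" "v \<in> homog q" "p < 2" "q < 2"
  shows "antipode (u * v) = (-1) ^ (p * q) *\<^sub>R (antipode v * antipode u)"
proof -
  have "antipode w \<in> homog r" if "w \<in> homog r" "r < 2" for w :: "'a uhc" and r
    using hpart_antipode[OF that(2), of w] hpart_in_homog[OF that(2), of "antipode w"]
      hpart_homog[OF that that(2)] by simp
  with assms show ?thesis by (simp add: antipode_hom sop_mult_homog)
qed

section \<open>Tensor products\<close>

datatype ('a, 'b) tterm =
    TPure 'a 'b | TZero | TAdd "('a, 'b) tterm" "('a, 'b) tterm" | TScl real "('a, 'b) tterm"

inductive teq :: "('a::real_vector, 'b::real_vector) tterm \<Rightarrow> ('a, 'b) tterm \<Rightarrow> bool" where
  t_refl: "teq s s"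
| t_sym: "teq s t \<Longrightarrow> teq t s"
| t_trans: "teq s t \<Longrightarrow> teq t r \<Longrightarrow> teq s r"
| t_cong_add: "teq s s' \<Longrightarrow> teq t t' \<Longrightarrow> teq (TAdd s t) (TAdd s' t')"
| t_cong_scl: "teq s s' \<Longrightarrow> teq (TScl c s) (TScl c s')"
| t_add_assoc: "teq (TAdd (TAdd s t) r) (TAdd s (TAdd t r))"
| t_add_comm: "teq (TAdd s t) (TAdd t s)"
| t_add_zero: "teq (TAdd TZero s) s"
| t_add_inv: "teq (TAdd (TScl (-1) s) s) TZero"
| t_scl_add: "teq (TScl c (TAdd s t)) (TAdd (TScl c s) (TScl c t))"
| t_add_scl: "teq (TScl (c + d) s) (TAdd (TScl c s) (TScl d s))"
| t_scl_scl: "teq (TScl c (TScl d s)) (TScl (c * d) s)"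
| t_scl_one: "teq (TScl 1 s) s"
| t_pure_add_left: "teq (TPure (a + a') b) (TAdd (TPure a b) (TPure a' b))"
| t_pure_add_right: "teq (TPure a (b + b')) (TAdd (TPure a b) (TPure a b'))"
| t_pure_scl_left: "teq (TPure (c *\<^sub>R a) b) (TScl c (TPure a b))"
| t_pure_scl_right: "teq (TPure a (c *\<^sub>R b)) (TScl c (TPure a b))"

quotient_type (overloaded) ('a, 'b) tensor = "('a::real_vector, 'b::real_vector) tterm" / teq
  by (rule equivpI) (auto simp: reflp_def symp_def transp_def intro: teq.intros)

instantiation tensor :: (real_vector, real_vector) real_vector
begin

lift_definition zero_tensor :: "('a, 'b) tensor" is TZero .
lift_definition plus_tensor :: "('a, 'b) tensor \<Rightarrow> ('a, 'b) tensor \<Rightarrow> ('a, 'b) tensor" is TAdd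
  by (rule teq.t_cong_add)
lift_definition scaleR_tensor :: "real \<Rightarrow> ('a, 'b) tensor \<Rightarrow> ('a, 'b) tensor" is TScl
  by (rule teq.t_cong_scl)
lift_definition uminus_tensor :: "('a, 'b) tensor \<Rightarrow> ('a, 'b) tensor" is "TScl (-1)"
  by (rule teq.t_cong_scl)
lift_definition minus_tensor :: "('a, 'b) tensor \<Rightarrow> ('a, 'b) tensor \<Rightarrow> ('a, 'b) tensor"
  is "\<lambda>s t. TAdd s (TScl (-1) t)"
  by (intro teq.t_cong_add teq.t_cong_scl)

instance
  by standard (transfer, auto intro: teq.intros)+

end

lift_definition tpure :: "'a::real_vector \<Rightarrow> 'b::real_vector \<Rightarrow> ('a, 'b) tensor"
  (infixr "\<otimes>\<^sub>t" 76) is TPure .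

lemma bilinear_tpure: "bilinear (\<otimes>\<^sub>t)"
  unfolding bilinear_def linear_iff
  by (intro conjI allI; transfer; rule teq.intros)

primrec teval :: "('a \<Rightarrow> 'b \<Rightarrow> 'c) \<Rightarrow> ('a, 'b) tterm \<Rightarrow> 'c::real_vector" where
  "teval B (TPure a b) = B a b"
| "teval B TZero = 0"
| "teval B (TAdd s t) = teval B s + teval B t"
| "teval B (TScl c s) = c *\<^sub>R teval B s"

text \<open>The linear map induced by a bilinear map, again computed on a representative.\<close>

definition tensor_lift ::
  "('a \<Rightarrow> 'b \<Rightarrow> 'c) \<Rightarrow> ('a::real_vector, 'b::real_vector) tensor \<Rightarrow> 'c::real_vector" where
  "tensor_lift B t = teval B (rep_tensor t)"

lemma teval_respects:
  assumes "bilinear B" "teq s t"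
  shows "teval B s = teval B t"
  using assms(2)
  by induction
    (simp_all add: bilinear_ladd[OF assms(1)] bilinear_radd[OF assms(1)]
      bilinear_lmul[OF assms(1)] bilinear_rmul[OF assms(1)] algebra_simps)

lemma tensor_lift_abs:
  assumes "bilinear B"
  shows "tensor_lift B (abs_tensor t) = teval B t"
  unfolding tensor_lift_def
  by (rule teval_respects[OF assms])
    (metis Quotient3_tensor rep_abs_rsp teq.t_refl teq.t_sym)

lemma tensor_lift_pure:
  assumes "bilinear B"
  shows "tensor_lift B (a \<otimes>\<^sub>t b) = B a b"
  by (simp add: tpure.abs_eq tensor_lift_abs[OF assms])

lemma linear_tensor_lift:
  assumes "bilinear B"
  shows "linear (tensor_lift B)"
proof (rule linearI)
  fix x y :: "('a, 'b) tensor" and c :: real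
  obtain s t where "x = abs_tensor s" "y = abs_tensor t"
    by (metis Quotient3_abs_rep Quotient3_tensor)
  then show "tensor_lift B (x + y) = tensor_lift B x + tensor_lift B y"
    "tensor_lift B (c *\<^sub>R x) = c *\<^sub>R tensor_lift B x"
    by (simp_all add: plus_tensor.abs_eq scaleR_tensor.abs_eq tensor_lift_abs[OF assms])
qed

lemma tensor_induct [case_names pure add]:
  assumes "\<And>a b. P (a \<otimes>\<^sub>t b)" "\<And>s t. P s \<Longrightarrow> P t \<Longrightarrow> P (s + t)"
  shows "P t"
proof -
  have "P (c *\<^sub>R abs_tensor s)" for c s
  proof (induction s arbitrary: c)
    case (TPure a b)
    then show ?case
      using assms(1)[of "c *\<^sub>R a" b] bilinear_lmul[OF bilinear_tpure, of c a b]
      by (simp flip: tpure.abs_eq)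
  next
    case TZero
    then show ?case
      using assms(1)[of 0 0]
      by (simp add: zero_tensor.abs_eq[symmetric] bilinear_lzero[OF bilinear_tpure])
  next
    case (TAdd s t)
    then show ?case
      using assms(2) by (simp add: plus_tensor.abs_eq[symmetric] scaleR_add_right)
  next
    case (TScl d s)
    then show ?case by (simp add: scaleR_tensor.abs_eq[symmetric])
  qed
  from this[of 1] show ?thesis
    by (metis Quotient3_abs_rep Quotient3_tensor scaleR_one)
qed

section \<open>Coproduct\<close>

text \<open>The product of \<open>a \<otimes> b\<close> and \<open>c \<otimes> d\<close>, with the sign \<open>(-1)\<^bsup>|b||c|\<^esup>\<close>, extended bilinearly.\<close>

definition stpure_mult :: "'n uhc \<Rightarrow> 'n uhc \<Rightarrow> 'n uhc \<Rightarrow> 'n uhc \<Rightarrow> ('n uhc, 'n uhc) tensor" where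
  "stpure_mult a b c d =
     (\<Sum>p\<in>{0, 1}. \<Sum>q\<in>{0, 1}. (-1) ^ (p * q) *\<^sub>R ((a * hpart q c) \<otimes>\<^sub>t (hpart p b * d)))"

definition stensor_mult ::
  "('n uhc, 'n uhc) tensor \<Rightarrow> ('n uhc, 'n uhc) tensor \<Rightarrow> ('n uhc, 'n uhc) tensor" where
  "stensor_mult s t = tensor_lift (\<lambda>a b. tensor_lift (\<lambda>c d. stpure_mult a b c d) t) s"

definition coproduct :: "'n uhc \<Rightarrow> ('n uhc, 'n uhc) tensor" where
  "coproduct = uhc_lift stensor_mult (1 \<otimes>\<^sub>t 1)
     (\<lambda>i. hc_a i \<otimes>\<^sub>t 1 + 1 \<otimes>\<^sub>t hc_a i) (hc_z \<otimes>\<^sub>t 1 + 1 \<otimes>\<^sub>t hc_z)"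

lemmas tpure_bilinear = bilinear_ladd[OF bilinear_tpure] bilinear_radd[OF bilinear_tpure]
  bilinear_lmul[OF bilinear_tpure] bilinear_rmul[OF bilinear_tpure]
  bilinear_lneg[OF bilinear_tpure] bilinear_rneg[OF bilinear_tpure]
  bilinear_lzero[OF bilinear_tpure] bilinear_rzero[OF bilinear_tpure]

lemma stpure_mult_linear:
  "linear (\<lambda>a. stpure_mult a b c d)" "linear (\<lambda>b. stpure_mult a b c d)"
  "linear (\<lambda>c. stpure_mult a b c d)" "linear (\<lambda>d. stpure_mult a b c d)"
  by (simp_all add: linear_iff stpure_mult_def tpure_bilinear linear_add[OF hpart_linear]
      linear_cmul[OF hpart_linear] algebra_simps)

lemma bilinear_stpure_right: "bilinear (\<lambda>c d. stpure_mult a b c d)"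
  by (simp add: bilinear_def stpure_mult_linear)

lemma bilinear_stpure_left: "bilinear (\<lambda>a b. tensor_lift (\<lambda>c d. stpure_mult a b c d) t)"
proof (induction t rule: tensor_induct)
  case (pure c d)
  then show ?case
    by (simp add: tensor_lift_pure bilinear_stpure_right bilinear_def stpure_mult_linear)
next
  case (add s t)
  then show ?case
    by (simp add: linear_add[OF linear_tensor_lift[OF bilinear_stpure_right]]
        bilinear_def linear_compose_add)
qed

lemma stensor_mult_pure: "stensor_mult (a \<otimes>\<^sub>t b) (c \<otimes>\<^sub>t d) = stpure_mult a b c d"
  unfolding stensor_mult_def tensor_lift_pure[OF bilinear_stpure_left]
  by (rule tensor_lift_pure[OF bilinear_stpure_right])

lemma stensor_mult_homog:
  assumes "b \<in> homog p" "c \<in> homog q" "p < 2" "q < 2"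
  shows "stensor_mult (a \<otimes>\<^sub>t b) (c \<otimes>\<^sub>t d) = (-1) ^ (p * q) *\<^sub>R ((a * c) \<otimes>\<^sub>t (b * d))"
  using assms(3,4) hpart_homog[OF assms(1,3)] hpart_homog[OF assms(2,4)]
  by (auto simp: stensor_mult_pure stpure_mult_def less_2_cases_iff tpure_bilinear)

lemma bilinear_stensor_mult: "bilinear stensor_mult"
  unfolding bilinear_def
proof (intro conjI allI)
  show "linear (\<lambda>s. stensor_mult s t)" for t :: "('a uhc, 'a uhc) tensor"
    unfolding stensor_mult_def by (rule linear_tensor_lift[OF bilinear_stpure_left])
  show "linear (\<lambda>t. stensor_mult s t)" for s :: "('a uhc, 'a uhc) tensor"
  proof (induction s rule: tensor_induct)
    case (pure a b)
    then show ?case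
      unfolding stensor_mult_def tensor_lift_pure[OF bilinear_stpure_left]
      by (rule linear_tensor_lift[OF bilinear_stpure_right])
  next
    case (add s t)
    have "stensor_mult (s + t) = (\<lambda>r. stensor_mult s r + stensor_mult t r)"
      unfolding stensor_mult_def by (simp add: linear_add[OF linear_tensor_lift[OF bilinear_stpure_left]])
    with add show ?case by (simp add: linear_compose_add)
  qed
qed

lemmas stensor_bilinear = bilinear_ladd[OF bilinear_stensor_mult]
  bilinear_radd[OF bilinear_stensor_mult] bilinear_lmul[OF bilinear_stensor_mult]
  bilinear_rmul[OF bilinear_stensor_mult]

lemma tensor_homog_induct [case_names homog add]:
  assumes "\<And>a b p q. a \<in> homog p \<Longrightarrow> b \<in> homog q \<Longrightarrow> p < 2 \<Longrightarrow> q < 2 \<Longrightarrow> P (a \<otimes>\<^sub>t b)"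
    and "\<And>s t. P s \<Longrightarrow> P t \<Longrightarrow> P (s + t)"
  shows "P (t :: ('n uhc, 'n uhc) tensor)"
proof (induction t rule: tensor_induct)
  case (pure a b)
  show ?case
  proof (induction a rule: homog_sum_induct)
    case a: (homog p a)
    show ?case
      by (induction b rule: homog_sum_induct) (use a assms in \<open>auto simp: tpure_bilinear\<close>)
  qed (simp add: tpure_bilinear assms)
qed (rule assms)

lemma unital_algebra_stensor: "unital_algebra stensor_mult (1 \<otimes>\<^sub>t (1 :: 'n uhc))"
  unfolding unital_algebra_def
proof (intro conjI allI)
  show "bilinear (stensor_mult :: ('n uhc, 'n uhc) tensor \<Rightarrow> _)" by (rule bilinear_stensor_mult)
  show "stensor_mult (stensor_mult x y) w = stensor_mult x (stensor_mult y w)"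
    for x y w :: "('n uhc, 'n uhc) tensor"
  proof (induction x rule: tensor_homog_induct)
    case x: (homog a b p p')
    show ?case
    proof (induction y rule: tensor_homog_induct)
      case y: (homog c d q q')
      show ?case
      proof (induction w rule: tensor_homog_induct)
        case w: (homog e f r r')
        have bd: "b * d \<in> homog ((p' + q') mod 2)" and ce: "c * e \<in> homog ((q + r) mod 2)"
          using x y w homog_mult by blast+
        show ?case
          using x y w
          by (simp add: stensor_mult_homog[OF x(2) y(1)] stensor_mult_homog[OF y(2) w(1)]
              stensor_mult_homog[OF bd w(1)] stensor_mult_homog[OF x(2) ce]
              stensor_bilinear mult.assoc)
            (auto simp: less_2_cases_iff)
      qed (simp add: stensor_bilinear)
    qed (simp add: stensor_bilinear)
  qed (simp add: stensor_bilinear)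
  show "stensor_mult (1 \<otimes>\<^sub>t 1) x = x" "stensor_mult x (1 \<otimes>\<^sub>t 1) = x" for x :: "('n uhc, 'n uhc) tensor"
    by (induction x rule: tensor_homog_induct)
      (simp_all add: stensor_mult_homog[OF homog_generators(1)]
        stensor_mult_homog[OF _ homog_generators(1)] stensor_bilinear)
qed

lemma hc_relations_stensor:
  "hc_relations stensor_mult (\<lambda>i. hc_a i \<otimes>\<^sub>t 1 + 1 \<otimes>\<^sub>t hc_a i) (hc_z \<otimes>\<^sub>t 1 + 1 \<otimes>\<^sub>t (hc_z :: 'n uhc))"
  unfolding hc_relations_def
proof (intro conjI allI impI)
  note g = homog_generators
  note m = stensor_mult_homog[OF g(1) g(1)] stensor_mult_homog[OF g(1) g(2)]
    stensor_mult_homog[OF g(1) g(3)] stensor_mult_homog[OF g(2) g(1)]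
    stensor_mult_homog[OF g(3) g(1)] stensor_mult_homog[OF g(3) g(3)]
    stensor_mult_homog[OF g(2) g(3)] stensor_mult_homog[OF g(3) g(2)]
  fix i j :: 'n
  let ?f = "\<lambda>i. hc_a i \<otimes>\<^sub>t 1 + 1 \<otimes>\<^sub>t hc_a i" and ?w = "hc_z \<otimes>\<^sub>t 1 + 1 \<otimes>\<^sub>t hc_z"
  show "stensor_mult (?f i) (?f j) = - stensor_mult (?f j) (?f i)" if "i \<noteq> j"
    unfolding stensor_bilinear using hc_a_anticomm[OF that] by (simp add: m tpure_bilinear)
  show "stensor_mult (?f i) (?f i) = ?w"
    unfolding stensor_bilinear by (simp add: m hc_a_square)
  show "stensor_mult ?w (?f i) = stensor_mult (?f i) ?w"
    unfolding stensor_bilinear by (simp add: m hc_z_central)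
qed

lemmas coproduct_hom =
  uhc_lift_hom[OF unital_algebra_stensor hc_relations_stensor, folded coproduct_def]

lemma antipode_hc_emb: "antipode (hc_emb x) = - hc_emb x"
  by (cases x) (simp add: hc_emb_def antipode_hom linear_sum[OF antipode_hom(8)] sum_negf)

lemma coproduct_hc_emb: "coproduct (hc_emb x) = hc_emb x \<otimes>\<^sub>t 1 + 1 \<otimes>\<^sub>t hc_emb x"
proof -
  have l: "linear (\<lambda>a. a \<otimes>\<^sub>t (1 :: 'a uhc))" "linear (\<lambda>a. (1 :: 'a uhc) \<otimes>\<^sub>t a)"
    using bilinear_tpure by (auto simp: bilinear_def)
  show ?thesis
    by (cases x) (simp add: hc_emb_def coproduct_hom linear_sum[OF coproduct_hom(8)] tpure_bilinear
        linear_sum[OF l(1)] linear_sum[OF l(2)] sum.distrib scaleR_add_right)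
qed

section \<open>Functions\<close>

definition smooth :: "(real \<Rightarrow> complex) \<Rightarrow> bool" where
  "smooth f \<longleftrightarrow> (\<exists>D :: nat \<Rightarrow> real \<Rightarrow> complex. D 0 = f \<and>
     (\<forall>k x. (D k has_vector_derivative D (Suc k) x) (at x)))"

definition HC_smooth :: "('n uhc \<Rightarrow> real \<Rightarrow> complex) set" where
  "HC_smooth = {F.
     (\<forall>u. smooth (F u)) \<and>
     (\<forall>u v x. F (u + v) x = F u x + F v x) \<and>
     (\<forall>c u x. F (c *\<^sub>R u) x = c *\<^sub>R F u x) \<and>
     (\<forall>u x. (F u has_vector_derivative F (hc_z * u) x) (at x))}"

definition HC_smooth_c :: "('n uhc \<Rightarrow> real \<Rightarrow> complex) set" where
  "HC_smooth_c = {F \<in> HC_smooth. \<exists>K. compact K \<and> (\<forall>u. closure {x. F u x \<noteq> 0} \<subseteq> K)}"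

text \<open>The even (\<open>q = 0\<close>) and odd (\<open>q = 1\<close>) component of a function.\<close>

definition fpart :: "nat \<Rightarrow> ('n uhc \<Rightarrow> real \<Rightarrow> complex) \<Rightarrow> 'n uhc \<Rightarrow> real \<Rightarrow> complex" where
  "fpart q F = (\<lambda>v. F (hpart q v))"

text \<open>The bilinear extension of the formula for homogeneous arguments; see \<open>L_alg_homog\<close>.\<close>

definition L_alg :: "'n uhc \<Rightarrow> ('n uhc \<Rightarrow> real \<Rightarrow> complex) \<Rightarrow> 'n uhc \<Rightarrow> real \<Rightarrow> complex" where
  "L_alg u F = (\<lambda>v y. \<Sum>p\<in>{0, 1}. \<Sum>q\<in>{0, 1}.
     (-1) ^ (p * q) * fpart q F (antipode (hpart p u) * v) y)"

definition L_shift :: "real \<Rightarrow> ('n uhc \<Rightarrow> real \<Rightarrow> complex) \<Rightarrow> 'n uhc \<Rightarrow> real \<Rightarrow> complex" where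
  "L_shift x F = (\<lambda>v y. F v (y - x))"

definition L :: "'n uhc \<Rightarrow> real \<Rightarrow> ('n uhc \<Rightarrow> real \<Rightarrow> complex) \<Rightarrow> 'n uhc \<Rightarrow> real \<Rightarrow> complex" where
  "L u x F = L_alg u (L_shift x F)"

lemma L_commute: "L_alg u (L_shift x F) = L_shift x (L_alg u F)"
  by (simp add: L_alg_def L_shift_def fpart_def)

lemma HC_smooth_zero: "F \<in> HC_smooth \<Longrightarrow> F 0 x = 0"
  unfolding HC_smooth_def by (metis (mono_tags, lifting) mem_Collect_eq scaleR_zero_left)

lemma L_alg_homog:
  assumes F: "F \<in> HC_smooth" and u: "u \<in> homog p" and p: "p < 2" and q: "q < 2"
    and van: "\<And>v. v \<in> homog (1 - q) \<Longrightarrow> F v = (\<lambda>_. 0)"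
  shows "L_alg u F v y = (-1) ^ (p * q) * F (antipode u * v) y"
proof -
  have add: "F w y = F (hpart 0 w) y + F (hpart (Suc 0) w) y" for w
    using F hpart_sum[of w] unfolding HC_smooth_def by (metis (mono_tags, lifting) mem_Collect_eq)
  have zero: "F (hpart (1 - q) w) y = 0" for w
    using van[OF hpart_in_homog, of w] by simp
  have h: "F (hpart r w) y = (if r = q then F w y else 0)" if "r < 2" for r w
    using q that zero[of w] add[of w] by (auto simp: less_2_cases_iff)
  have u': "hpart r u = (if r = p then u else 0)" if "r < 2" for r
    using hpart_homog[OF u p that] .
  show ?thesis
    using p q by (auto simp: L_alg_def fpart_def h u' antipode_hom HC_smooth_zero[OF F] less_2_cases_iff)
qed

lemma fpart_sum: "F \<in> HC_smooth \<Longrightarrow> F v x = fpart 0 F v x + fpart 1 F v x"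
  unfolding HC_smooth_def fpart_def using hpart_sum[of v]
  by (metis (mono_tags, lifting) One_nat_def mem_Collect_eq)

section \<open>Representations\<close>

text \<open>
  With \<open>k = n div 2\<close>, the \<open>2 ^ k\<close> standard basis vectors of the \<open>k\<close>-fold tensor power of the
  two-dimensional space are indexed by maps from \<open>{1..k}\<close> to the two-element type \<open>2\<close>.
\<close>

typedef 'n tidx = "PiE {1..CARD('n) div 2} (\<lambda>_. UNIV :: 2 set)"
  by (rule exI[of _ "\<lambda>l. if l \<in> {1..CARD('n) div 2} then 1 else undefined"]) auto

instance tidx :: (type) finite
proof
  have "(UNIV :: 'a tidx set) = Abs_tidx ` PiE {1..CARD('a) div 2} (\<lambda>_. UNIV)"
    by (metis type_definition.Abs_image type_definition_tidx)
  moreover have "finite (PiE {1..CARD('a) div 2} (\<lambda>_. UNIV :: 2 set))"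
    by (intro finite_PiE) auto
  ultimately show "finite (UNIV :: 'a tidx set)"
    by (metis finite_imageI)
qed

type_synonym 'n cmat = "complex ^ 'n tidx ^ 'n tidx"

definition cscale :: "complex \<Rightarrow> complex ^ 'a ^ 'b \<Rightarrow> complex ^ 'a ^ 'b" where
  "cscale c A = (\<chi> i j. c * A $ i $ j)"

text \<open>The matrix \<open>M 1 \<otimes> \<dots> \<otimes> M k\<close>.\<close>

definition tensor_mat :: "(nat \<Rightarrow> complex ^ 2 ^ 2) \<Rightarrow> 'n cmat" where
  "tensor_mat M = (\<chi> r s. \<Prod>l\<in>{1..CARD('n) div 2}. M l $ Rep_tidx r l $ Rep_tidx s l)"

definition sigma_mat :: "complex ^ 2 ^ 2" where
  "sigma_mat = vector [vector [1, 0], vector [0, -1]]"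

definition X_mat :: "complex \<Rightarrow> complex ^ 2 ^ 2" where
  "X_mat \<zeta> = vector [vector [0, \<zeta>], vector [1, 0]]"

definition Y_mat :: "complex \<Rightarrow> complex ^ 2 ^ 2" where
  "Y_mat \<zeta> = vector [vector [0, \<i> * \<zeta>], vector [- \<i>, 0]]"

text \<open>\<open>cliff \<zeta> m\<close> is \<open>c\<^sub>\<zeta>(a\<^sub>m)\<close> of the even case; the tensor slot of \<open>a\<^sub>m\<close> is \<open>(m + 1) div 2\<close>.\<close>

definition cliff :: "complex \<Rightarrow> nat \<Rightarrow> 'n cmat" where
  "cliff \<zeta> m = tensor_mat (\<lambda>l.
     if l < (m + 1) div 2 then sigma_mat
     else if l = (m + 1) div 2 then (if odd m then X_mat \<zeta> else Y_mat \<zeta>)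
     else mat 1)"

definition Gamma_mat :: "'n cmat" where
  "Gamma_mat = tensor_mat (\<lambda>_. sigma_mat)"

text \<open>\<open>pos i\<close> is the number \<open>j\<close> such that \<open>hc_a i\<close> is \<open>a\<^sub>j\<close>.\<close>

definition pos :: "'n::{finite, linorder} \<Rightarrow> nat" where
  "pos i = card {..i}"

definition hc_gamma :: "'n::{finite, linorder} uhc" where
  "hc_gamma = prod_list (map hc_a (sorted_list_of_set UNIV))"

definition dpi_even :: "complex \<Rightarrow> 'n::{finite, linorder} uhc \<Rightarrow> 'n cmat" where
  "dpi_even \<zeta> = uhc_lift (**) (mat 1)
     (\<lambda>i. cscale (exp (\<i> * of_real pi / 4)) (cliff \<zeta> (pos i))) (cscale (\<i> * \<zeta>) (mat 1))"

text \<open>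
  In the odd case the pair \<open>(A, B)\<close> stands for \<open>1 \<otimes> A + \<epsilon> \<otimes> B\<close>. The matrix factor is
  \<open>Mat(\<complex>\<^bsup>2^k\<^esup>)\<close> with \<open>\<complex>\<^bsup>2^k\<^esup>\<close> purely even, so no signs arise.
\<close>

type_synonym 'n dmat = "'n cmat \<times> 'n cmat"

definition dmult :: "complex \<Rightarrow> 'n dmat \<Rightarrow> 'n dmat \<Rightarrow> 'n dmat" where
  "dmult \<zeta> S T = (fst S ** fst T + cscale \<zeta> (snd S ** snd T), fst S ** snd T + snd S ** fst T)"

definition dscale :: "complex \<Rightarrow> 'n dmat \<Rightarrow> 'n dmat" where
  "dscale c S = (cscale c (fst S), cscale c (snd S))"

definition dunit :: "'n dmat" where
  "dunit = (mat 1, 0)"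

definition cliff_odd :: "nat \<Rightarrow> 'n dmat" where
  "cliff_odd m = (0, if m = 1 then Gamma_mat else cscale (- \<i>) (Gamma_mat ** cliff 1 (m - 1)))"

definition dpi_odd :: "complex \<Rightarrow> 'n::{finite, linorder} uhc \<Rightarrow> 'n dmat" where
  "dpi_odd \<zeta> = uhc_lift (dmult \<zeta>) dunit
     (\<lambda>i. dscale (exp (\<i> * of_real pi / 4)) (cliff_odd (pos i))) (dscale (\<i> * \<zeta>) dunit)"

definition pi_even :: "complex \<Rightarrow> 'n::{finite, linorder} uhc \<Rightarrow> real \<Rightarrow> 'n cmat" where
  "pi_even \<zeta> u x = cscale (exp (\<i> * \<zeta> * of_real x)) (dpi_even \<zeta> u)"

definition pi_odd :: "complex \<Rightarrow> 'n::{finite, linorder} uhc \<Rightarrow> real \<Rightarrow> 'n dmat" where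
  "pi_odd \<zeta> u x = dscale (exp (\<i> * \<zeta> * of_real x)) (dpi_odd \<zeta> u)"

lemma pos_less_iff: "i < j \<Longrightarrow> pos i < pos j" for i j :: "'n::{finite, linorder}"
  unfolding pos_def by (rule psubset_card_mono) auto

lemma pos_bounds: "1 \<le> pos i" "pos i \<le> CARD('n)" for i :: "'n::{finite, linorder}"
proof -
  have "{..i} \<noteq> {}" by auto
  then show "1 \<le> pos i" by (simp add: pos_def card_gt_0_iff Suc_le_eq)
qed (auto simp: pos_def intro: card_mono)

lemma bilinear_matrix_mult: "bilinear ((**) :: complex ^ 'a::finite ^ 'a \<Rightarrow> _)"
  by (simp add: bilinear_def linear_iff matrix_matrix_mult_def vec_eq_iff sum.distrib
      scaleR_sum_right distrib_left distrib_right)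

lemma cscale_mult:
  "cscale c A ** B = cscale c (A ** B)" "A ** cscale c B = cscale c (A ** B)"
  "cscale c (cscale d A) = cscale (c * d) A" "cscale c (A + A') = cscale c A + cscale c A'"
  "cscale c (- A) = - cscale c A" "cscale 1 A = A" "cscale c 0 = 0" "cscale (-1) A = - A"
  "cscale c (r *\<^sub>R A) = r *\<^sub>R cscale c A"
  by (simp_all add: cscale_def matrix_matrix_mult_def vec_eq_iff sum_distrib_left mult.assoc
      mult.left_commute distrib_left)

lemma tensor_mat_mult: "tensor_mat M ** tensor_mat N = (tensor_mat (\<lambda>l. M l ** N l) :: 'n cmat)"
proof (rule vec_eq_iff[THEN iffD2], rule allI, rule vec_eq_iff[THEN iffD2], rule allI)
  fix r s :: "'n tidx"
  let ?I = "{1..CARD('n) div 2}"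
  have bij: "bij_betw (Rep_tidx :: 'n tidx \<Rightarrow> _) UNIV (PiE ?I (\<lambda>_. UNIV))"
    by (metis bij_betw_def inj_on_def Rep_tidx_inject type_definition.Rep_range type_definition_tidx)
  have "(tensor_mat (\<lambda>l. M l ** N l) :: 'n cmat) $ r $ s
      = (\<Prod>l\<in>?I. \<Sum>t\<in>UNIV. M l $ Rep_tidx r l $ t * N l $ t $ Rep_tidx s l)"
    by (simp add: tensor_mat_def matrix_matrix_mult_def)
  also have "\<dots> = (\<Sum>g\<in>PiE ?I (\<lambda>_. UNIV). \<Prod>l\<in>?I. M l $ Rep_tidx r l $ g l * N l $ g l $ Rep_tidx s l)"
    by (rule prod_sum_PiE) auto
  also have "\<dots> = (\<Sum>t\<in>(UNIV :: 'n tidx set). \<Prod>l\<in>?I. M l $ Rep_tidx r l $ Rep_tidx t l * N l $ Rep_tidx t l $ Rep_tidx s l)"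
    using sum.reindex_bij_betw[OF bij,
        of "\<lambda>g. \<Prod>l\<in>?I. M l $ Rep_tidx r l $ g l * N l $ g l $ Rep_tidx s l"] by simp
  also have "\<dots> = (tensor_mat M ** tensor_mat N) $ r $ s"
    by (simp add: tensor_mat_def matrix_matrix_mult_def prod.distrib)
  finally show "(tensor_mat M ** tensor_mat N) $ r $ s = (tensor_mat (\<lambda>l. M l ** N l) :: 'n cmat) $ r $ s" ..
qed

lemma tensor_mat_cong:
  "(\<And>l. 1 \<le> l \<Longrightarrow> l \<le> CARD('n) div 2 \<Longrightarrow> M l = N l) \<Longrightarrow> tensor_mat M = (tensor_mat N :: 'n cmat)"
  by (simp add: tensor_mat_def vec_eq_iff)

lemma tensor_mat_one: "tensor_mat (\<lambda>_. mat 1) = (mat 1 :: 'n cmat)"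
proof -
  have "(\<Prod>l\<in>{1..CARD('n) div 2}. if Rep_tidx r l = Rep_tidx s l then 1 else 0 :: complex)
      = (if r = s then 1 else 0)" for r s :: "'n tidx"
  proof (cases "r = s")
    case False
    then have "Rep_tidx r \<noteq> Rep_tidx s" by (simp add: Rep_tidx_inject)
    then obtain l where l: "l \<in> {1..CARD('n) div 2}" "Rep_tidx r l \<noteq> Rep_tidx s l"
      using PiE_ext[OF Rep_tidx Rep_tidx] by blast
    then have "(\<Prod>l\<in>{1..CARD('n) div 2}. if Rep_tidx r l = Rep_tidx s l then 1 else 0 :: complex) = 0"
      by (intro prod_zero) auto
    then show ?thesis using False by simp
  qed simp
  then show ?thesis by (simp add: tensor_mat_def mat_def vec_eq_iff)
qed

lemma tensor_mat_scale_slot: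
  assumes "1 \<le> l0" "l0 \<le> CARD('n) div 2" "M l0 = cscale c (N l0)"
    and "\<And>l. l \<noteq> l0 \<Longrightarrow> M l = N l"
  shows "tensor_mat M = (cscale c (tensor_mat N) :: 'n cmat)"
proof -
  have "(\<Prod>l\<in>{1..CARD('n) div 2}. M l $ f l $ g l)
      = c * (\<Prod>l\<in>{1..CARD('n) div 2}. N l $ f l $ g l)" for f g :: "nat \<Rightarrow> 2"
  proof -
    have l0: "l0 \<in> {1..CARD('n) div 2}" using assms by auto
    have "(\<Prod>l\<in>{1..CARD('n) div 2} - {l0}. M l $ f l $ g l)
        = (\<Prod>l\<in>{1..CARD('n) div 2} - {l0}. N l $ f l $ g l)"
      by (rule prod.cong) (auto simp: assms(4))
    then show ?thesis
      unfolding prod.remove[OF finite_atLeastAtMost l0] by (simp add: assms(3) cscale_def)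
  qed
  then show ?thesis by (simp add: tensor_mat_def cscale_def vec_eq_iff)
qed

lemma mat2_relations:
  "sigma_mat ** sigma_mat = mat 1"
  "X_mat \<zeta> ** X_mat \<zeta> = cscale \<zeta> (mat 1)" "Y_mat \<zeta> ** Y_mat \<zeta> = cscale \<zeta> (mat 1)"
  "sigma_mat ** X_mat \<zeta> = cscale (-1) (X_mat \<zeta> ** sigma_mat)"
  "sigma_mat ** Y_mat \<zeta> = cscale (-1) (Y_mat \<zeta> ** sigma_mat)"
  "X_mat \<zeta> ** Y_mat \<zeta> = cscale (-1) (Y_mat \<zeta> ** X_mat \<zeta>)"
  by (simp_all add: vec_eq_iff forall_2 matrix_matrix_mult_def sum_2 cscale_def mat_def
      sigma_mat_def X_mat_def Y_mat_def vector_2 mult_ac)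

lemma cliff_square:
  assumes "1 \<le> m" "m \<le> 2 * (CARD('n) div 2)"
  shows "cliff \<zeta> m ** cliff \<zeta> m = (cscale \<zeta> (mat 1) :: 'n cmat)"
  unfolding cliff_def tensor_mat_mult tensor_mat_one[symmetric]
  by (rule tensor_mat_scale_slot[of "(m + 1) div 2"]) (use assms in \<open>auto simp: mat2_relations\<close>)

lemma cliff_anticomm_less:
  assumes "1 \<le> m" "m < m'" "m' \<le> 2 * (CARD('n) div 2)"
  shows "cliff \<zeta> m ** cliff \<zeta> m' = - (cliff \<zeta> m' ** cliff \<zeta> m :: 'n cmat)"
proof (cases "(m + 1) div 2 = (m' + 1) div 2")
  case True
  then have "odd m \<and> even m'" using assms by presburger
  then show ?thesis
    unfolding cliff_def tensor_mat_mult cscale_mult(8)[symmetric] True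
    by (intro tensor_mat_scale_slot[of "(m' + 1) div 2"]) (use assms in \<open>auto simp: mat2_relations\<close>)
next
  case False
  then have "(m + 1) div 2 < (m' + 1) div 2" using assms(2) by presburger
  then show ?thesis
    unfolding cliff_def tensor_mat_mult cscale_mult(8)[symmetric]
    by (intro tensor_mat_scale_slot[of "(m + 1) div 2"])
      (use assms in \<open>auto simp: mat2_relations cscale_mult\<close>)
qed

lemma cliff_anticomm:
  assumes "1 \<le> m" "1 \<le> m'" "m \<noteq> m'" "m \<le> 2 * (CARD('n) div 2)" "m' \<le> 2 * (CARD('n) div 2)"
  shows "cliff \<zeta> m ** cliff \<zeta> m' = - (cliff \<zeta> m' ** cliff \<zeta> m :: 'n cmat)"
proof (cases "m < m'")
  case True
  then show ?thesis using cliff_anticomm_less[of m m', where 'n = 'n] assms by simp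
next
  case False
  then show ?thesis using cliff_anticomm_less[of m' m, where 'n = 'n] assms by simp
qed

lemma Gamma_square: "Gamma_mat ** Gamma_mat = (mat 1 :: 'n cmat)"
  by (simp add: Gamma_mat_def tensor_mat_mult mat2_relations tensor_mat_one)

lemma Gamma_cliff:
  assumes "1 \<le> m" "m \<le> 2 * (CARD('n) div 2)"
  shows "Gamma_mat ** cliff \<zeta> m = - (cliff \<zeta> m ** Gamma_mat :: 'n cmat)"
  unfolding cliff_def Gamma_mat_def tensor_mat_mult cscale_mult(8)[symmetric]
  by (rule tensor_mat_scale_slot[of "(m + 1) div 2"]) (use assms in \<open>auto simp: mat2_relations\<close>)

lemma exp_square: "exp (\<i> * of_real pi / 4) * exp (\<i> * of_real pi / 4) = \<i>"
proof -
  have "exp (\<i> * of_real pi / 4) = cis (pi / 4)" by (simp add: cis_conv_exp)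
  then show ?thesis by (simp add: cis_mult flip: cis_pi_half)
qed

lemma unital_algebra_mat: "unital_algebra (**) (mat 1 :: 'n cmat)"
  by (simp add: unital_algebra_def bilinear_matrix_mult matrix_mul_assoc)

lemma hc_relations_even:
  assumes "even CARD('n::{finite, linorder})"
  shows "hc_relations (**) (\<lambda>i::'n. cscale (exp (\<i> * of_real pi / 4)) (cliff \<zeta> (pos i)))
    (cscale (\<i> * \<zeta>) (mat 1) :: 'n cmat)"
proof -
  have b: "1 \<le> pos i" "pos i \<le> 2 * (CARD('n) div 2)" for i :: 'n
    using pos_bounds[of i] assms by auto
  have ne: "pos i \<noteq> pos j" if "i \<noteq> j" for i j :: 'n
    using that pos_less_iff by (metis linorder_neq_iff)
  show ?thesis
    unfolding hc_relations_def
  proof (intro conjI allI impI)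
    fix i j :: 'n
    let ?f = "\<lambda>i. cscale (exp (\<i> * of_real pi / 4)) (cliff \<zeta> (pos i)) :: 'n cmat"
    show "?f i ** ?f j = - (?f j ** ?f i)" if "i \<noteq> j"
      using cliff_anticomm[OF b(1) b(1) ne[OF that] b(2) b(2), of \<zeta>] by (simp add: cscale_mult)
    show "?f i ** ?f i = cscale (\<i> * \<zeta>) (mat 1)"
      by (simp add: cscale_mult cliff_square[OF b] exp_square mult.assoc[symmetric])
    show "cscale (\<i> * \<zeta>) (mat 1) ** ?f i = ?f i ** cscale (\<i> * \<zeta>) (mat 1)"
      by (simp add: cscale_mult mult.commute)
  qed
qed

lemmas dpi_even_hom =
  uhc_lift_hom[OF unital_algebra_mat hc_relations_even, folded dpi_even_def]

lemma unital_algebra_dmult: "unital_algebra (dmult \<zeta>) (dunit :: 'n dmat)"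
  unfolding unital_algebra_def
proof (intro conjI allI)
  note bl = bilinear_ladd[OF bilinear_matrix_mult] bilinear_radd[OF bilinear_matrix_mult]
    bilinear_lmul[OF bilinear_matrix_mult] bilinear_rmul[OF bilinear_matrix_mult]
    bilinear_lzero[OF bilinear_matrix_mult] bilinear_rzero[OF bilinear_matrix_mult]
  show "bilinear (dmult \<zeta> :: 'n dmat \<Rightarrow> _)"
    by (simp add: bilinear_def linear_iff dmult_def bl cscale_mult prod_eq_iff scaleR_add_right
        add_ac)
  show "dmult \<zeta> (dmult \<zeta> x y) w = dmult \<zeta> x (dmult \<zeta> y w)" for x y w :: "'n dmat"
    by (simp add: dmult_def bl cscale_mult prod_eq_iff matrix_mul_assoc add_ac)
  show "dmult \<zeta> dunit x = x" "dmult \<zeta> x dunit = x" for x :: "'n dmat"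
    by (simp_all add: dmult_def dunit_def bl cscale_mult)
qed

definition cliff_odd_mat :: "nat \<Rightarrow> 'n cmat" where
  "cliff_odd_mat m = snd (cliff_odd m)"

lemma cliff_odd_mat_relations:
  assumes "1 \<le> m" "1 \<le> m'" "m \<le> 2 * (CARD('n) div 2) + 1" "m' \<le> 2 * (CARD('n) div 2) + 1"
  shows "cliff_odd_mat m ** cliff_odd_mat m = (mat 1 :: 'n cmat)"
    and "m \<noteq> m' \<Longrightarrow> cliff_odd_mat m ** cliff_odd_mat m' = - (cliff_odd_mat m' ** cliff_odd_mat m :: 'n cmat)"
proof -
  note neg = bilinear_lneg[OF bilinear_matrix_mult] bilinear_rneg[OF bilinear_matrix_mult]
  let ?G = "Gamma_mat :: 'n cmat"
  have GG: "?G ** (?G ** A) = A" for A :: "'n cmat"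
    by (simp add: matrix_mul_assoc Gamma_square)
  have CG: "cliff 1 r ** (?G ** A) = - (?G ** (cliff 1 r ** A))"
    if "1 \<le> r" "r \<le> 2 * (CARD('n) div 2)" for r and A :: "'n cmat"
    using Gamma_cliff[OF that, of 1] by (simp add: matrix_mul_assoc neg)
  have CG': "cliff 1 r ** ?G = - (?G ** cliff 1 r)"
    if "1 \<le> r" "r \<le> 2 * (CARD('n) div 2)" for r
    using Gamma_cliff[OF that, of 1] by simp
  have prod: "(?G ** cliff 1 r) ** (?G ** cliff 1 s) = - (cliff 1 r ** cliff 1 s)"
    if "1 \<le> r" "r \<le> 2 * (CARD('n) div 2)" for r s
    by (simp add: matrix_mul_assoc[symmetric] CG[OF that] neg GG)
  show "cliff_odd_mat m ** cliff_odd_mat m = (mat 1 :: 'n cmat)"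
    using assms prod[of "m - 1" "m - 1"] cliff_square[of "m - 1" 1, where 'n = 'n]
    by (cases "m = 1") (auto simp: cliff_odd_mat_def cliff_odd_def Gamma_square cscale_mult)
  show "cliff_odd_mat m ** cliff_odd_mat m' = - (cliff_odd_mat m' ** cliff_odd_mat m :: 'n cmat)" if neq: "m \<noteq> m'"
  proof -
    consider "m = 1" "m' > 1" | "m' = 1" "m > 1" | "m > 1" "m' > 1" using assms(1,2) neq by linarith
    then show ?thesis
    proof cases
      case 1
      then show ?thesis
        using assms by (simp add: cliff_odd_mat_def cliff_odd_def cscale_mult GG
            matrix_mul_assoc[symmetric] CG' neg)
    next
      case 2
      then show ?thesis
        using assms by (simp add: cliff_odd_mat_def cliff_odd_def cscale_mult GG
            matrix_mul_assoc[symmetric] CG' neg)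
    next
      case 3
      then show ?thesis
        using assms neq cliff_anticomm[of "m - 1" "m' - 1" 1, where 'n = 'n]
        by (simp add: cliff_odd_mat_def cliff_odd_def cscale_mult prod)
    qed
  qed
qed

lemma hc_relations_odd:
  assumes "odd CARD('n::{finite, linorder})"
  shows "hc_relations (dmult \<zeta>) (\<lambda>i::'n. dscale (exp (\<i> * of_real pi / 4)) (cliff_odd (pos i)))
    (dscale (\<i> * \<zeta>) dunit :: 'n dmat)"
proof -
  have b: "1 \<le> pos i" "pos i \<le> 2 * (CARD('n) div 2) + 1" for i :: 'n
    using pos_bounds[of i] assms by auto
  have ne: "pos i \<noteq> pos j" if "i \<noteq> j" for i j :: 'n
    using that pos_less_iff by (metis linorder_neq_iff)
  have o: "cliff_odd m = (0, cliff_odd_mat m :: 'n cmat)" for m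
    by (simp add: cliff_odd_mat_def cliff_odd_def)
  note z = bilinear_lzero[OF bilinear_matrix_mult] bilinear_rzero[OF bilinear_matrix_mult]
  show ?thesis
    unfolding hc_relations_def
  proof (intro conjI allI impI)
    fix i j :: 'n
    let ?f = "\<lambda>i. dscale (exp (\<i> * of_real pi / 4)) (cliff_odd (pos i) :: 'n dmat)"
    show "dmult \<zeta> (?f i) (?f j) = - dmult \<zeta> (?f j) (?f i)" if "i \<noteq> j"
      using cliff_odd_mat_relations(2)[OF b(1) b(1) b(2) b(2) ne[OF that]]
      by (simp add: dmult_def dscale_def o cscale_mult z)
    show "dmult \<zeta> (?f i) (?f i) = dscale (\<i> * \<zeta>) dunit"
      using cliff_odd_mat_relations(1)[OF b(1) b(1) b(2) b(2)]
      by (simp add: dmult_def dscale_def dunit_def o cscale_mult z exp_square mult.commute)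
    show "dmult \<zeta> (dscale (\<i> * \<zeta>) dunit) (?f i) = dmult \<zeta> (?f i) (dscale (\<i> * \<zeta>) dunit)"
      by (simp add: dmult_def dscale_def dunit_def o cscale_mult z mult.commute)
  qed
qed

lemmas dpi_odd_hom =
  uhc_lift_hom[OF unital_algebra_dmult hc_relations_odd, folded dpi_odd_def]

section \<open>Fourier transform\<close>

text \<open>
  The sum over the terms of \<open>\<Delta>(\<gamma>)\<close> is the value on \<open>\<Delta>(\<gamma>)\<close> of the linear map induced by a
  bilinear map. Here \<open>sc\<close> is complex scalar multiplication on the target.
\<close>

definition fourier ::
  "(complex \<Rightarrow> 'h \<Rightarrow> 'h) \<Rightarrow> (complex \<Rightarrow> 'n::{finite, linorder} uhc \<Rightarrow> 'h::real_vector) \<Rightarrow>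
   ('n uhc \<Rightarrow> real \<Rightarrow> complex) \<Rightarrow> complex \<Rightarrow> 'h" where
  "fourier sc dpi F \<zeta> = tensor_lift
     (\<lambda>p q. sc (\<integral>x. F p x * exp (- \<i> * \<zeta> * of_real x) \<partial>lborel) (dpi (- \<zeta>) q))
     (coproduct hc_gamma)"

definition fourier_even ::
  "('n::{finite, linorder} uhc \<Rightarrow> real \<Rightarrow> complex) \<Rightarrow> complex \<Rightarrow> 'n cmat" where
  "fourier_even = fourier cscale dpi_even"

definition fourier_odd ::
  "('n::{finite, linorder} uhc \<Rightarrow> real \<Rightarrow> complex) \<Rightarrow> complex \<Rightarrow> 'n dmat" where
  "fourier_odd = fourier dscale dpi_odd"

lemma HC_smooth_c_integrable:
  assumes "F \<in> HC_smooth_c"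
  shows "integrable lborel (\<lambda>x. F u x * exp (- \<i> * \<zeta> * of_real x))"
proof -
  from assms obtain K where K: "compact K" "\<And>u. closure {x. F u x \<noteq> 0} \<subseteq> K"
    and F: "F \<in> HC_smooth" unfolding HC_smooth_c_def by auto
  have "continuous_on UNIV (F u)"
    using F by (auto simp: HC_smooth_def intro!: continuous_at_imp_continuous_on
        has_vector_derivative_continuous)
  then have "continuous_on K (\<lambda>x. F u x * exp (- \<i> * \<zeta> * of_real x))"
    by (intro continuous_intros) (auto intro: continuous_on_subset)
  from borel_integrable_compact[OF K(1) this]
  have "integrable lborel (\<lambda>x. indicator K x *\<^sub>R (F u x * exp (- \<i> * \<zeta> * of_real x)))" .
  moreover have "F u x = 0" if "x \<notin> K" for x
    using K(2)[of u] closure_subset[of "{x. F u x \<noteq> 0}"] that by auto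
  then have "(\<lambda>x. indicator K x *\<^sub>R (F u x * exp (- \<i> * \<zeta> * of_real x)))
      = (\<lambda>x. F u x * exp (- \<i> * \<zeta> * of_real x))"
    by (auto simp: fun_eq_iff indicator_def)
  ultimately show ?thesis by simp
qed

lemma fourier_bilinear:
  assumes F: "F \<in> HC_smooth_c" and sc: "bilinear sc" and dpi: "linear (dpi (- \<zeta>))"
  shows "bilinear (\<lambda>p q. sc (\<integral>x. F p x * exp (- \<i> * \<zeta> * of_real x) \<partial>lborel) (dpi (- \<zeta>) q))"
proof -
  note int = HC_smooth_c_integrable[OF F]
  from F have F': "F (u + v) x = F u x + F v x" "F (c *\<^sub>R u) x = c *\<^sub>R F u x" for u v c x
    by (auto simp: HC_smooth_c_def HC_smooth_def)
  show ?thesis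
    unfolding bilinear_def linear_iff
    using int
    by (simp add: F' distrib_right linear_add[OF dpi] linear_cmul[OF dpi] bilinear_ladd[OF sc]
        bilinear_radd[OF sc] bilinear_lmul[OF sc] bilinear_rmul[OF sc])
qed

lemma fourier_eq_sum:
  assumes "F \<in> HC_smooth_c" "bilinear sc" "linear (dpi (- \<zeta>))"
    and \<Delta>: "coproduct hc_gamma = (\<Sum>i\<in>I. g1 i \<otimes>\<^sub>t g2 i)"
  shows "fourier sc dpi F \<zeta>
    = (\<Sum>i\<in>I. sc (\<integral>x. F (g1 i) x * exp (- \<i> * \<zeta> * of_real x) \<partial>lborel) (dpi (- \<zeta>) (g2 i)))"
proof -
  note b = fourier_bilinear[of F sc dpi \<zeta>, OF assms(1-3)]
  show ?thesis
    unfolding fourier_def \<Delta> linear_sum[OF linear_tensor_lift[OF b]] tensor_lift_pure[OF b] ..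
qed

lemma bilinear_cscale: "bilinear cscale"
  by (simp add: bilinear_def linear_iff cscale_def vec_eq_iff distrib_left distrib_right)

lemma bilinear_dscale: "bilinear dscale"
  by (simp add: bilinear_def linear_iff dscale_def prod_eq_iff cscale_mult
      bilinear_ladd[OF bilinear_cscale] bilinear_lmul[OF bilinear_cscale])

lemmas fourier_even_eq_sum =
  fourier_eq_sum[OF _ bilinear_cscale dpi_even_hom(8), folded fourier_even_def]
lemmas fourier_odd_eq_sum =
  fourier_eq_sum[OF _ bilinear_dscale dpi_odd_hom(8), folded fourier_odd_def]

end

theory Submission
  imports Defs
begin

text \<open>
  Only the functional \<open>G(v) = \<integral> F(v; y) e\<^bsup>-i\<zeta>y\<^esup> dy\<close> enters the Fourier transform of \<open>F\<close>; it satisfies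
  \<open>G(zv) = i\<zeta> G(v)\<close> by integration by parts, and a shift of \<open>F\<close> multiplies it by a scalar. Since
  \<open>L\<^sub>u\<close> and \<open>d\<pi>\<close> are both multiplicative in \<open>u\<close>, it is enough to treat the generators. The
  difference of the two sides for \<open>u = a\<^sub>i\<close> is, up to sign, the value of
  \<open>(G \<circ> grading) \<otimes> d\<pi>\<close> on \<open>\<Delta>(a\<^sub>i \<gamma>)\<close>. Now \<open>a\<^sub>i \<gamma>\<close> is a multiple of \<open>z\<close>, and this map
  vanishes on multiples of \<open>\<Delta>(z)\<close>, because \<open>z\<close> acts by opposite scalars in the two factors.
\<close>

section \<open>Powers of the grading, the antipode, and products with
  \<open>hc_gamma\<close>\<close>

text \<open>Each \<open>grading\<close> negates the odd part, so its \<open>p\<close>-th power acts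
  on \<open>hpart q v\<close> by the sign in the sum. This turns the inner sum of
  \<open>L_alg\<close> into composition with an automorphism.\<close>

lemma sum_sign_hpart:
  assumes "linear G"
  shows "(\<Sum>q\<in>{0, 1}. (-1) ^ (p * q) * G (hpart q v)) = (G ((grading ^^ p) v) :: complex)"
proof (induction p arbitrary: v)
  case 0
  show ?case by (simp add: hpart_sum linear_add[OF assms, symmetric])
next
  case (Suc p)
  have "hpart 0 (grading v) = hpart 0 v" "hpart 1 (grading v) = - hpart 1 v"
    by (simp_all add: hpart_def algebra_simps)
  with Suc[of "grading v"] show ?case
    by (simp add: funpow_Suc_right linear_neg[OF assms] del: funpow.simps)
qed

lemma linear_grading_funpow: "linear (grading ^^ p)"
proof (induction p)
  case 0
  show ?case by (simp add: linear_iff)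
next
  case (Suc p)
  then show ?case unfolding funpow.simps by (rule linear_compose[OF _ grading_hom(8)])
qed

lemma grading_funpow_mult: "(grading ^^ p) (u * v) = (grading ^^ p) u * (grading ^^ p) v"
  by (induction p) (simp_all add: grading_hom)

lemma grading_funpow_homog: "u \<in> homog q \<Longrightarrow> (grading ^^ p) u = (-1) ^ (p * q) *\<^sub>R u"
  by (induction p) (simp_all add: grading_homog grading_hom power_add)

lemma grading_funpow_mod_2: "(grading ^^ (p mod 2)) u = (grading ^^ p) u"
  by (induction p rule: nat_induct2) simp_all

lemma antipode_in_homog: "u \<in> homog p \<Longrightarrow> p < 2 \<Longrightarrow> antipode u \<in> homog p"
  using hpart_antipode[of p u] hpart_in_homog[of p "antipode u"] hpart_homog[of u p p] by simp

text \<open>Move \<open>hc_a i\<close> to the right, with a sign at each foreign factor, until it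
  meets its first own copy. There the square yields \<open>hc_z\<close>, which is central and
  returns to the front.\<close>

lemma hc_a_mult_prod_list:
  "i \<in> set is \<Longrightarrow> \<exists>y. hc_a i * prod_list (map hc_a is) = hc_z * y"
proof (induction "is")
  case (Cons j js)
  show ?case
  proof (cases "i = j")
    case True
    then show ?thesis by (auto simp: hc_a_square mult.assoc[symmetric])
  next
    case False
    with Cons obtain y where y: "hc_a i * prod_list (map hc_a js) = hc_z * y" by auto
    have "hc_a i * prod_list (map hc_a (j # js)) = - (hc_a j * (hc_a i * prod_list (map hc_a js)))"
      using hc_a_anticomm[OF False] by (simp add: mult.assoc[symmetric])
    also have "\<dots> = hc_z * - (hc_a j * y)"
      by (simp add: y mult.assoc[symmetric] hc_z_commute_a)
    finally show ?thesis by blast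
  qed
qed simp

section \<open>Left translation of functionals\<close>

text \<open>The counterpart of \<open>L_alg\<close> for scalar functionals, that is, with the real
  variable integrated out.\<close>

definition transl :: "'n uhc \<Rightarrow> ('n uhc \<Rightarrow> complex) \<Rightarrow> 'n uhc \<Rightarrow> complex" where
  "transl u G v = (\<Sum>p\<in>{0, 1}. \<Sum>q\<in>{0, 1}. (-1) ^ (p * q) * G (hpart q (antipode (hpart p u) * v)))"

context
  fixes G :: "'n uhc \<Rightarrow> complex"
  assumes G: "linear G"
begin

lemma transl_eq: "transl u G v = (\<Sum>p\<in>{0, 1}. G ((grading ^^ p) (antipode (hpart p u) * v)))"
  unfolding transl_def sum_sign_hpart[OF G] ..

lemma transl_homog:
  assumes "u \<in> homog p" "p < 2"
  shows "transl u G v = G ((grading ^^ p) (antipode u * v))"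
proof -
  have "p = 0 \<or> p = 1" using assms by auto
  then show ?thesis
    using hpart_homog[OF assms(1,2)] by (auto simp: transl_eq antipode_hom grading_hom linear_0[OF G])
qed

lemma linear_transl: "linear (transl u G)"
proof (rule linearI)
  note lin = linear_add[OF G] linear_cmul[OF G] linear_add[OF linear_grading_funpow]
    linear_cmul[OF linear_grading_funpow]
  show "transl u G (v + w) = transl u G v + transl u G w" for v w
    by (simp only: transl_eq lin distrib_left sum.distrib)
  show "transl u G (r *\<^sub>R v) = r *\<^sub>R transl u G v" for r v
    by (simp only: transl_eq lin mult_scaleR_right scaleR_sum_right)
qed

lemma transl_add: "transl (u + v) G w = transl u G w + transl v G w"
  by (simp add: transl_eq linear_add[OF hpart_linear] antipode_hom distrib_right grading_hom
      linear_add[OF G])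

lemma transl_scale: "transl (r *\<^sub>R u) G w = r *\<^sub>R transl u G w"
  by (simp add: transl_eq linear_cmul[OF hpart_linear] antipode_hom grading_hom
      linear_cmul[OF G] scaleR_add_right)

lemma transl_hc_z: "transl hc_z G v = - G (hc_z * v)"
  using transl_homog[OF homog_generators(2)] by (simp add: antipode_hom linear_neg[OF G])

lemma transl_one: "transl 1 G v = G v"
  using transl_homog[OF homog_generators(1)] by (simp add: antipode_hom)

text \<open>The sign of the antipode cancels against the sign of \<open>grading\<close> on
  \<open>hc_a i\<close>.\<close>

lemma transl_hc_a: "transl (hc_a i) G v = G (hc_a i * grading v)"
  using transl_homog[OF homog_generators(3)]
    linear_neg[OF grading_hom(8), of "hc_a i"] linear_neg[OF grading_hom(8), of "hc_a i * v"]
  by (simp add: antipode_hom grading_hom)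

end

text \<open>For homogeneous \<open>u\<close>, \<open>v\<close> two equal signs meet: one from the
  antipode reversing \<open>u * v\<close>, the other from extending \<open>grading ^^ p\<close> over
  the factor \<open>antipode v\<close> of parity \<open>q\<close>. The general case follows by
  additivity.\<close>

lemma transl_mult:
  assumes G: "linear G"
  shows "transl (u * v) G w = transl u (transl v G) w"
proof (induction u rule: homog_sum_induct)
  case u: (homog p u)
  show ?case
  proof (induction v rule: homog_sum_induct)
    case v: (homog q v)
    have uv: "u * v \<in> homog ((q + p) mod 2)"
      using homog_mult[OF u(2) v(2)] by (simp add: add.commute)
    have "transl u (transl v G) w
        = G ((grading ^^ q) (antipode v * (grading ^^ p) (antipode u * w)))"
      using transl_homog[OF linear_transl[OF G] u(2,1)] transl_homog[OF G v(2,1)] by simp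
    also have "antipode v * (grading ^^ p) (antipode u * w)
        = (-1) ^ (p * q) *\<^sub>R ((grading ^^ p) (antipode v) * (grading ^^ p) (antipode u * w))"
      by (simp add: grading_funpow_homog[OF antipode_in_homog[OF v(2,1)]])
    also have "\<dots> = (grading ^^ p) (antipode (u * v) * w)"
      by (simp add: antipode_mult[OF u(2) v(2) u(1) v(1)] grading_funpow_mult mult.assoc
          linear_cmul[OF linear_grading_funpow])
    also have "(grading ^^ q) \<dots> = (grading ^^ ((q + p) mod 2)) (antipode (u * v) * w)"
      by (simp add: grading_funpow_mod_2 funpow_add)
    finally show ?case
      by (simp add: transl_homog[OF G uv])
  next
    case (add v v')
    have "transl (v + v') G = (\<lambda>w. transl v G w + transl v' G w)"
      by (simp add: fun_eq_iff transl_add[OF G])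
    then have "transl u (transl (v + v') G) w = transl u (transl v G) w + transl u (transl v' G) w"
      by (simp add: transl_def sum.distrib algebra_simps)
    then show ?case
      using add by (simp only: distrib_left transl_add[OF G, of "u * v" "u * v'" w])
  qed
next
  case (add u u')
  then show ?case
    by (simp add: distrib_right transl_add[OF G] transl_add[OF linear_transl[OF G]])
qed

text \<open>Since \<open>hc_z\<close> is central and fixed by \<open>grading\<close>, it can be
  moved outside. This preserves the hypothesis on \<open>G\<close> when translations are
  iterated.\<close>

lemma transl_eigen:
  assumes "linear G" and z: "\<And>v. G (hc_z * v) = k * G v"
  shows "transl u G (hc_z * v) = k * transl u G v"
proof -
  have gz: "(grading ^^ p) hc_z = hc_z" for p
    by (induction p) (simp_all add: grading_hom)
  have "x * (hc_z * y) = hc_z * (x * y)" for x y :: "'a uhc"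
    by (metis hc_z_central mult.assoc)
  then have "(grading ^^ p) (x * (hc_z * v)) = hc_z * (grading ^^ p) (x * v)" for p x
    by (metis grading_funpow_mult gz)
  then show ?thesis
    unfolding transl_eq[OF assms(1)] sum_distrib_left by (simp only: z)
qed

section \<open>Pairing a functional with a representation\<close>

text \<open>Covers the targets for even and odd \<open>n\<close> at once. Complex scaling
  \<open>sc\<close> is a parameter because the type \<open>'h\<close> carries only a real structure;
  \<open>c\<close> is the scalar by which \<open>hc_z\<close> acts.\<close>

locale hc_representation =
  fixes mul :: "'h::real_vector \<Rightarrow> 'h \<Rightarrow> 'h" and e :: 'h
    and sc :: "complex \<Rightarrow> 'h \<Rightarrow> 'h"
    and \<rho> :: "'n::{finite, linorder} uhc \<Rightarrow> 'h" and c :: complex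
  assumes unital: "unital_algebra mul e"
    and bilinear_sc: "bilinear sc"
    and sc_sc: "sc a (sc b x) = sc (a * b) x"
    and sc_mul: "mul (sc a x) y = sc a (mul x y)"
    and mul_sc: "mul x (sc a y) = sc a (mul x y)"
    and linear_rep: "linear \<rho>"
    and rep_one: "\<rho> 1 = e"
    and rep_mult: "\<rho> (u * v) = mul (\<rho> u) (\<rho> v)"
    and rep_z: "\<rho> hc_z = sc c e"
begin

definition pairing :: "('n uhc \<Rightarrow> complex) \<Rightarrow> ('n uhc, 'n uhc) tensor \<Rightarrow> 'h" where
  "pairing G = tensor_lift (\<lambda>p q. sc (G p) (\<rho> q))"

lemma bilinear_mul: "bilinear mul"
  and mul_assoc: "mul (mul x y) w = mul x (mul y w)"
  and unit_mul: "mul e x = x"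
  using unital by (auto simp: unital_algebra_def)

lemma bilinear_pairing: "linear G \<Longrightarrow> bilinear (\<lambda>p q. sc (G p) (\<rho> q))"
  unfolding bilinear_def linear_iff
  by (simp add: linear_add linear_cmul linear_add[OF linear_rep] linear_cmul[OF linear_rep]
      bilinear_ladd[OF bilinear_sc] bilinear_radd[OF bilinear_sc] bilinear_lmul[OF bilinear_sc]
      bilinear_rmul[OF bilinear_sc])

lemma pairing_pure: "linear G \<Longrightarrow> pairing G (p \<otimes>\<^sub>t q) = sc (G p) (\<rho> q)"
  unfolding pairing_def by (rule tensor_lift_pure[OF bilinear_pairing])

lemma linear_pairing: "linear G \<Longrightarrow> linear (pairing G)"
  unfolding pairing_def by (rule linear_tensor_lift[OF bilinear_pairing])

lemma pairing_add_left:
  assumes "linear G" "linear H"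
  shows "pairing (\<lambda>v. G v + H v) t = pairing G t + pairing H t"
proof (induction t rule: tensor_induct)
  case (pure a b)
  show ?case
    by (simp add: pairing_pure assms linear_compose_add bilinear_ladd[OF bilinear_sc])
next
  case (add s t)
  then show ?case
    by (simp add: linear_add[OF linear_pairing] assms linear_compose_add)
qed

lemma pairing_sc_left:
  assumes "linear G"
  shows "pairing (\<lambda>v. k * G v) t = sc k (pairing G t)"
proof -
  have l: "linear (\<lambda>v. k * G v)"
    by (rule linearI) (simp_all add: linear_add[OF assms] linear_cmul[OF assms] distrib_left)
  show ?thesis
    by (induction t rule: tensor_induct)
      (simp_all add: pairing_pure l assms sc_sc linear_add[OF linear_pairing] bilinear_radd[OF bilinear_sc])
qed

lemma pairing_scaleR_left:
  assumes "linear G"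
  shows "pairing (\<lambda>v. r *\<^sub>R G v) t = r *\<^sub>R pairing G t"
  by (induction t rule: tensor_induct)
    (simp_all add: pairing_pure assms linear_compose_scale_right bilinear_lmul[OF bilinear_sc]
      linear_add[OF linear_pairing] scaleR_add_right)

text \<open>On \<open>a\<close> tensor \<open>b\<close>, the summand with \<open>hc_a i\<close> in
  the second slot carries the sign of moving past \<open>a\<close>; composing \<open>G\<close> with
  \<open>grading\<close> removes it. In the other summand \<open>grading\<close> negates
  \<open>hc_a i\<close>, which gives minus the translation.\<close>

lemma pairing_coproduct_a:
  assumes G: "linear G"
  shows "pairing (G \<circ> grading) (stensor_mult (coproduct (hc_a i)) t)
    = mul (\<rho> (hc_a i)) (pairing G t) - pairing (transl (hc_a i) G) t"
proof -
  define G' where "G' = G \<circ> grading"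
  define H where "H = transl (hc_a i) G"
  have G': "linear G'" "G' v = G (grading v)" for v
    unfolding G'_def by (auto intro: linear_compose[OF grading_hom(8) G])
  have H: "linear H" "H v = G (hc_a i * grading v)" for v
    unfolding H_def by (rule linear_transl[OF G], rule transl_hc_a[OF G])
  have "pairing G' (stensor_mult (coproduct (hc_a i)) t)
      = mul (\<rho> (hc_a i)) (pairing G t) - pairing H t"
  proof (induction t rule: tensor_homog_induct)
    case (homog a b p q)
    have "p = 0 \<or> p = 1" using homog by auto
    then show ?case
      using grading_homog[OF homog(1)]
      by (auto simp: coproduct_hom stensor_bilinear stensor_mult_homog[OF homog_generators(1) homog(1)]
          stensor_mult_homog[OF homog_generators(3) homog(1)]
          linear_add[OF linear_pairing] linear_diff[OF linear_pairing] linear_neg[OF linear_pairing]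
          pairing_pure[OF G'(1)] pairing_pure[OF H(1)] pairing_pure[OF G]
          G'(1) G'(2)[of a] G'(2)[of "hc_a i * a"] H(2)[of a] grading_hom rep_mult mul_sc linear_neg[OF G] bilinear_lneg[OF bilinear_sc])
  next
    case (add s t)
    then show ?case
      by (simp add: stensor_bilinear linear_add[OF linear_pairing] G'(1) G H(1) bilinear_radd[OF bilinear_mul])
  qed
  then show ?thesis by (simp only: G'_def H_def)
qed

text \<open>The even element \<open>hc_z\<close> produces no sign; the two summands contribute the
  scalars \<open>- c\<close> and \<open>c\<close>.\<close>

lemma pairing_coproduct_z:
  assumes G: "linear G" and z: "\<And>v. G (hc_z * v) = - c * G v"
  shows "pairing G (stensor_mult (coproduct hc_z) t) = 0"
proof (induction t rule: tensor_homog_induct)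
  case (homog a b p q)
  have "\<rho> (hc_z * b) = sc c (\<rho> b)"
    by (simp add: rep_mult rep_z sc_mul unit_mul)
  then show ?case
    by (simp add: coproduct_hom stensor_bilinear stensor_mult_homog[OF homog_generators(1) homog(1)]
        stensor_mult_homog[OF homog_generators(2) homog(1)] homog linear_add[OF linear_pairing[OF G]]
        pairing_pure[OF G] z bilinear_lneg[OF bilinear_sc] sc_sc mult.commute)
next
  case (add s t)
  then show ?case
    by (simp add: stensor_bilinear linear_add[OF linear_pairing[OF G]])
qed

text \<open>The functional \<open>G\<close> must vary in the induction, since the product case uses
  the hypothesis for \<open>u\<close> at \<open>transl v G\<close>.\<close>

lemma pairing_transl:
  assumes "linear G" "\<And>v. G (hc_z * v) = - c * G v"
  shows "pairing (transl u G) (coproduct hc_gamma) = mul (\<rho> u) (pairing G (coproduct hc_gamma))"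
  using assms
proof (induction u arbitrary: G rule: uhc_induct)
  case (a i)
  note G = \<open>linear G\<close>
  have lin: "linear (G \<circ> grading)"
    by (rule linear_compose[OF grading_hom(8) G])
  have eigen: "(G \<circ> grading) (hc_z * v) = - c * (G \<circ> grading) v" for v
    by (simp add: grading_hom a(2))
  \<comment> \<open>Every index occurs in \<open>hc_gamma\<close>, so the product is divisible by
    \<open>hc_z\<close>; multiplicativity of \<open>coproduct\<close> then transfers this to the
    tensor product.\<close>
  obtain y where y: "hc_a i * hc_gamma = hc_z * y"
    using hc_a_mult_prod_list[of i "sorted_list_of_set UNIV"] by (auto simp: hc_gamma_def)
  have "stensor_mult (coproduct (hc_a i)) (coproduct hc_gamma)
      = stensor_mult (coproduct hc_z) (coproduct y)"
    using y by (simp flip: coproduct_hom(6))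
  then have "pairing (G \<circ> grading) (stensor_mult (coproduct (hc_a i)) (coproduct hc_gamma)) = 0"
    by (simp only: pairing_coproduct_z[OF lin eigen])
  then show ?case
    by (simp add: pairing_coproduct_a[OF G])
next
  case z
  \<comment> \<open>The antipode negates \<open>hc_z\<close>, which cancels the minus sign of the
    eigenvalue \<open>- c\<close>.\<close>
  have "transl hc_z G = (\<lambda>v. c * G v)"
    by (simp add: fun_eq_iff transl_hc_z[OF z(1)] z(2))
  then show ?case
    by (simp add: pairing_sc_left z rep_z sc_mul unit_mul)
next
  case zero
  have "transl 0 G = (\<lambda>v. 0 *\<^sub>R G v)"
    using transl_scale[OF zero(1), of 0 0] by (simp add: fun_eq_iff)
  then show ?case
    using pairing_scaleR_left[OF zero(1), of 0]
    by (simp add: linear_0[OF linear_rep] bilinear_lzero[OF bilinear_mul])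
next
  case one
  have "transl 1 G = G" by (simp add: fun_eq_iff transl_one[OF one(1)])
  then show ?case by (simp add: rep_one unit_mul)
next
  case (add u v)
  have "transl (u + v) G = (\<lambda>w. transl u G w + transl v G w)"
    by (simp add: fun_eq_iff transl_add[OF add.prems(1)])
  then show ?case
    using add by (simp add: pairing_add_left linear_transl linear_add[OF linear_rep] bilinear_ladd[OF bilinear_mul])
next
  case (mult u v)
  have "transl (u * v) G = transl u (transl v G)"
    by (simp add: fun_eq_iff transl_mult[OF mult.prems(1)])
  then show ?case
    \<comment> \<open>First peel off \<open>u\<close> at the functional \<open>transl v G\<close>,
      then \<open>v\<close> at \<open>G\<close> itself.\<close>
    using mult.IH(1)[OF linear_transl[OF mult.prems(1)] transl_eigen[OF mult.prems]] mult.IH(2)[OF mult.prems]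
    by (simp add: rep_mult mul_assoc)
next
  case (scale r u)
  have "transl (r *\<^sub>R u) G = (\<lambda>w. r *\<^sub>R transl u G w)"
    by (simp add: fun_eq_iff transl_scale[OF scale.prems(1)])
  then show ?case
    using scale by (simp add: pairing_scaleR_left linear_transl linear_cmul[OF linear_rep] bilinear_lmul[OF bilinear_mul])
qed

end

section \<open>The Fourier transform of the coefficients\<close>

definition fourier_coeff :: "('n uhc \<Rightarrow> real \<Rightarrow> complex) \<Rightarrow> complex \<Rightarrow> 'n uhc \<Rightarrow> complex" where
  "fourier_coeff F \<zeta> v = (\<integral>y. F v y * exp (- \<i> * \<zeta> * of_real y) \<partial>lborel)"

lemma integral_vector_derivative_compact_support:
  fixes f :: "real \<Rightarrow> complex"
  assumes f: "\<And>x. (f has_vector_derivative f' x) (at x)" and f': "continuous_on UNIV f'"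
    and K: "compact K" "\<And>x. x \<notin> K \<Longrightarrow> f x = 0 \<and> f' x = 0"
  shows "(\<integral>x. f' x \<partial>lborel) = 0"
proof -
  obtain r where "\<And>x. x \<in> K \<Longrightarrow> \<bar>x\<bar> \<le> r" and "r > 0"
    using compact_imp_bounded[OF K(1)] by (metis bounded_pos real_norm_def)
  then have r: "f x = 0 \<and> f' x = 0" if "\<bar>x\<bar> > r" for x
    using K(2)[of x] that by force
  have "(\<integral>x. f' x \<partial>lborel) = (\<integral>x. indicator {- (r + 1)..r + 1} x *\<^sub>R f' x \<partial>lborel)"
    using r by (intro Bochner_Integration.integral_cong) (auto simp: indicator_def not_le abs_if)
  also have "\<dots> = f (r + 1) - f (- (r + 1))"
    using \<open>r > 0\<close> f' f
    by (intro integral_FTC_Icc)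
      (auto intro: has_vector_derivative_at_within continuous_on_subset)
  also have "\<dots> = 0" using r[of "r + 1"] r[of "- (r + 1)"] \<open>r > 0\<close> by simp
  finally show ?thesis .
qed

context
  fixes F :: "'n uhc \<Rightarrow> real \<Rightarrow> complex"
  assumes F: "F \<in> HC_smooth_c"
begin

lemma linear_fourier_coeff: "linear (fourier_coeff F \<zeta>)"
proof (rule linearI)
  note int = HC_smooth_c_integrable[OF F]
  have F': "F (u + v) x = F u x + F v x" "F (r *\<^sub>R u) x = r *\<^sub>R F u x" for u v r x
    using F by (auto simp: HC_smooth_c_def HC_smooth_def)
  show "fourier_coeff F \<zeta> (u + v) = fourier_coeff F \<zeta> u + fourier_coeff F \<zeta> v" for u v
    using int[of u \<zeta>] int[of v \<zeta>] by (simp add: fourier_coeff_def F' distrib_right)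
  show "fourier_coeff F \<zeta> (r *\<^sub>R u) = r *\<^sub>R fourier_coeff F \<zeta> u" for r u
    by (simp add: fourier_coeff_def F')
qed

lemma fourier_coeff_hc_z: "fourier_coeff F \<zeta> (hc_z * v) = - (\<i> * - \<zeta>) * fourier_coeff F \<zeta> v"
proof -
  let ?E = "\<lambda>y. exp (- \<i> * \<zeta> * of_real y)"
  let ?f' = "\<lambda>y. F (hc_z * v) y * ?E y - \<i> * \<zeta> * (F v y * ?E y)"
  obtain K where K: "compact K" "\<And>u. closure {x. F u x \<noteq> 0} \<subseteq> K"
    using F unfolding HC_smooth_c_def by auto
  have zero: "F u y = 0" if "y \<notin> K" for u y
    using K(2)[of u] closure_subset[of "{x. F u x \<noteq> 0}"] that by auto
  have dF: "(F u has_vector_derivative F (hc_z * u) y) (at y)" for u y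
    using F by (auto simp: HC_smooth_c_def HC_smooth_def)
  have cF: "continuous_on UNIV (F u)" for u
    using dF by (auto intro!: continuous_at_imp_continuous_on has_vector_derivative_continuous)
  have dE: "(?E has_vector_derivative - \<i> * \<zeta> * ?E y) (at y)" for y
    by (rule has_vector_derivative_real_field) (auto intro!: derivative_eq_intros)
  have "((\<lambda>y. F v y * ?E y) has_vector_derivative ?f' y) (at y)" for y
    using has_vector_derivative_mult[OF dF dE] by (simp add: algebra_simps)
  then have "(\<integral>y. ?f' y \<partial>lborel) = 0"
    by (rule integral_vector_derivative_compact_support[OF _ _ K(1)])
      (auto intro!: continuous_intros cF simp: zero)
  moreover have "(\<integral>y. ?f' y \<partial>lborel) = fourier_coeff F \<zeta> (hc_z * v) - \<i> * \<zeta> * fourier_coeff F \<zeta> v"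
    using HC_smooth_c_integrable[OF F, of _ \<zeta>] by (simp add: fourier_coeff_def)
  ultimately show ?thesis by simp
qed

lemma shifted_fourier_integral:
  shows "integrable lborel (\<lambda>y. F v (y - x) * exp (- \<i> * \<zeta> * of_real y))"
    and "(\<integral>y. F v (y - x) * exp (- \<i> * \<zeta> * of_real y) \<partial>lborel)
      = exp (- \<i> * \<zeta> * of_real x) * fourier_coeff F \<zeta> v"
proof -
  let ?f = "\<lambda>y. F v y * exp (- \<i> * \<zeta> * of_real y)"
  have e: "F v (y - x) * exp (- \<i> * \<zeta> * of_real y) = exp (- \<i> * \<zeta> * of_real x) * ?f (- x + 1 * y)" for y
    by (simp add: algebra_simps flip: exp_add)
  have "integrable lborel (\<lambda>y. ?f (- x + 1 * y))"
    by (rule lborel_integrable_real_affine[OF HC_smooth_c_integrable[OF F]]) simp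
  then show "integrable lborel (\<lambda>y. F v (y - x) * exp (- \<i> * \<zeta> * of_real y))"
    unfolding e by (rule integrable_mult_right)
  show "(\<integral>y. F v (y - x) * exp (- \<i> * \<zeta> * of_real y) \<partial>lborel)
      = exp (- \<i> * \<zeta> * of_real x) * fourier_coeff F \<zeta> v"
    unfolding e fourier_coeff_def
    using lborel_integral_real_affine[of 1 ?f "- x"] by simp
qed

lemma fourier_coeff_L:
  "fourier_coeff (L u x F) \<zeta> v = exp (- \<i> * \<zeta> * of_real x) * transl u (fourier_coeff F \<zeta>) v"
proof -
  have "fourier_coeff (L u x F) \<zeta> v = (\<integral>y. (\<Sum>p\<in>{0, 1}. \<Sum>q\<in>{0, 1}. (-1) ^ (p * q) *
      (F (hpart q (antipode (hpart p u) * v)) (y - x) * exp (- \<i> * \<zeta> * of_real y))) \<partial>lborel)"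
    unfolding fourier_coeff_def L_def L_alg_def fpart_def L_shift_def sum_distrib_right mult.assoc ..
  also have "\<dots> = (\<Sum>p\<in>{0, 1}. \<Sum>q\<in>{0, 1}. (-1) ^ (p * q) *
      (exp (- \<i> * \<zeta> * of_real x) * fourier_coeff F \<zeta> (hpart q (antipode (hpart p u) * v))))"
    unfolding shifted_fourier_integral(2)[symmetric]
    by (subst Bochner_Integration.integral_sum,
        intro Bochner_Integration.integrable_sum integrable_mult_right shifted_fourier_integral(1))+
      (simp only: integral_mult_right_zero)
  also have "\<dots> = exp (- \<i> * \<zeta> * of_real x) * transl u (fourier_coeff F \<zeta>) v"
    unfolding transl_def sum_distrib_left by (simp only: mult.left_commute)
  finally show ?thesis .
qed

end

lemma fourier_L:
  fixes F :: "'n::{finite, linorder} uhc \<Rightarrow> real \<Rightarrow> complex"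
  assumes F: "F \<in> HC_smooth_c" and rep: "hc_representation mul e sc (dpi (- \<zeta>)) (\<i> * - \<zeta>)"
  shows "fourier sc dpi (L u x F) \<zeta>
    = mul (sc (exp (\<i> * - \<zeta> * of_real x)) (dpi (- \<zeta>) u)) (fourier sc dpi F \<zeta>)"
proof -
  interpret hc_representation mul e sc "dpi (- \<zeta>)" "\<i> * - \<zeta>" by (rule rep)
  have four: "fourier sc dpi H \<zeta> = pairing (fourier_coeff H \<zeta>) (coproduct hc_gamma)" for H
    unfolding fourier_def pairing_def fourier_coeff_def ..
  have "fourier_coeff (L u x F) \<zeta>
      = (\<lambda>v. exp (\<i> * - \<zeta> * of_real x) * transl u (fourier_coeff F \<zeta>) v)"
    by (simp add: fun_eq_iff fourier_coeff_L[OF F])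
  then show ?thesis
    by (simp only: four pairing_sc_left[OF linear_transl[OF linear_fourier_coeff[OF F]]]
        pairing_transl[OF linear_fourier_coeff[OF F] fourier_coeff_hc_z[OF F]] sc_mul)
qed

lemma hc_representation_even:
  assumes "even CARD('n::{finite, linorder})"
  shows "hc_representation (**) (mat 1) cscale (dpi_even \<zeta> :: 'n uhc \<Rightarrow> 'n cmat) (\<i> * \<zeta>)"
  by unfold_locales
    (simp_all add: unital_algebra_mat bilinear_cscale cscale_mult dpi_even_hom[OF assms])

lemma hc_representation_odd:
  assumes "odd CARD('n::{finite, linorder})"
  shows "hc_representation (dmult \<zeta>) dunit dscale (dpi_odd \<zeta> :: 'n uhc \<Rightarrow> 'n dmat) (\<i> * \<zeta>)"
  by unfold_locales
    (simp_all add: unital_algebra_dmult bilinear_dscale dmult_def dscale_def cscale_mult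
      mult.commute dpi_odd_hom[OF assms])

theorem theorem1:
  fixes F :: "'n::{finite, linorder} uhc \<Rightarrow> real \<Rightarrow> complex"
    and \<zeta> :: complex and u :: "'n uhc" and x :: real
  assumes "F \<in> HC_smooth_c"
  shows "(even CARD('n) \<longrightarrow>
            fourier_even (L u x F) \<zeta> = pi_even (- \<zeta>) u x ** fourier_even F \<zeta>) \<and>
         (odd CARD('n) \<longrightarrow>
            fourier_odd (L u x F) \<zeta> = dmult (- \<zeta>) (pi_odd (- \<zeta>) u x) (fourier_odd F \<zeta>))"
  unfolding fourier_even_def fourier_odd_def pi_even_def pi_odd_def
  using fourier_L[where dpi = dpi_even, OF assms hc_representation_even]
    fourier_L[where dpi = dpi_odd, OF assms hc_representation_odd] by blast

end
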